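(* Let $\mathcal{D}\subseteq\omega$ be an at most countable set of digits, let $\mathcal{I}=\{I_n=[\ell_n,r_n): n\in\mathcal{D}\}$ be a family of pairwise disjoint nonempty intervals contained in $[0,1]$ with $\sum_{n\in\mathcal{D}}(r_n-\ell_n)=1$, let $\epsilon\colon\mathcal{D}\to\{0,1\}$ be a function, and let $T_{\mathcal{I},\epsilon}\colon[0,1]\to[0,1]$ be the generalized GLS expansion map associated with the pair $(\mathcal{I},\epsilon)$. If $\mu$ is a $T_{\mathcal{I},\epsilon}$-invariant Borel probability measure on $[0,1]$ with $\mu(\{0\})=0$, then the set of $x\in[0,1]$ which generate $\mu$ is $\mathbf{\Pi}^0_3$-complete. Furthermore, the set of irregular points for $T_{\mathcal{I},\epsilon}$ is $\mathbf{\Sigma}^0_3$-complete.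
   Context: $\omega=\{0,1,2,\ldots\}$. Put $I_\infty=[0,1]\setminus\bigcup_{n\in\mathcal{D}}I_n$. The map $T=T_{\mathcal{I},\epsilon}$ is defined by: $T(x)=0$ for $x\in I_\infty$; for $n\in\mathcal{D}$, the restriction of $T$ to $I_n$ is the affine map with positive slope from $I_n=[\ell_n,r_n)$ onto $[0,1)$ if $\epsilon(n)=0$, and the affine map with negative slope from $I_n$ onto $(0,1]$ if $\epsilon(n)=1$. A Borel probability measure $\mu$ on $[0,1]$ is $T$-invariant if $\mu(B)=\mu(T^{-1}(B))$ for all Borel $B\subseteq[0,1]$. A point $x\in[0,1]$ generates $\mu$ if for every interval $I\subseteq[0,1]$ with $\mu(\partial I)=0$ (boundary taken in $[0,1]$) one has $\lim_{N\to\infty}\frac1N|\{0\le n<N: T^n(x)\in I\}|=\mu(I)$. For $a_1,\ldots,a_k\in\mathcal{D}$ let $\Delta(a_1,\ldots,a_k)=\{y\in[0,1]: T^{j-1}(y)\in I_{a_j}\text{ for }1\le j\le k\}$. A point $x\in[0,1]$ is irregular for $T$ (equivalently, has irregular $(\mathcal{I},\epsilon)$-GLS expansion) if there are $k\ge1$ and $a_1,\ldots,a_k\in\mathcal{D}$ such that $\frac1N|\{0\le n<N:T^n(x)\in\Delta(a_1,\ldots,a_k)\}|$ does not converge as $N\to\infty$. In $[0,1]$: $\mathbf{\Sigma}^0_1$ = open sets, $\mathbf{\Pi}^0_k$ = complements of $\mathbf{\Sigma}^0_k$ sets, $\mathbf{\Sigma}^0_{k+1}$ = countable unions of $\mathbf{\Pi}^0_k$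 sets. A set is $\mathbf{\Pi}^0_3$-complete if it is in $\mathbf{\Pi}^0_3\setminus\mathbf{\Sigma}^0_3$, and $\mathbf{\Sigma}^0_3$-complete if it is in $\mathbf{\Sigma}^0_3\setminus\mathbf{\Pi}^0_3$.
   Formalization: The digit set D is additionally assumed to have at least two elements; with a single digit, T is the identity or x ↦ 1−x on [0,1), no point is irregular and the set of points generating μ is finite, so both claims fail. *)

theory Defs
  imports "HOL-Probability.Probability"
begin

section \<open>The finite levels of the Borel hierarchy\<close>

text \<open>The hierarchy starts at level 1; level 0 is a dummy.\<close>

fun borel_Sigma :: "'a topology \<Rightarrow> nat \<Rightarrow> 'a set set" where
  "borel_Sigma X 0 = {}"
| "borel_Sigma X (Suc 0) = {U. openin X U}"
| "borel_Sigma X (Suc (Suc k)) =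
     {\<Union>(range A) | A :: nat \<Rightarrow> 'a set.
        range A \<subseteq> (\<lambda>S. topspace X - S) ` borel_Sigma X (Suc k)}"

definition borel_Pi :: "'a topology \<Rightarrow> nat \<Rightarrow> 'a set set" where
  "borel_Pi X k = (\<lambda>S. topspace X - S) ` borel_Sigma X k"

definition Pi3_complete :: "'a topology \<Rightarrow> 'a set \<Rightarrow> bool" where
  "Pi3_complete X A \<longleftrightarrow> A \<in> borel_Pi X 3 - borel_Sigma X 3"

definition Sigma3_complete :: "'a topology \<Rightarrow> 'a set \<Rightarrow> bool" where
  "Sigma3_complete X A \<longleftrightarrow> A \<in> borel_Sigma X 3 - borel_Pi X 3"

abbreviation unit_top :: "real topology" where
  "unit_top \<equiv> top_of_set {0..1}"

section \<open>Generalized GLS expansion maps\<close>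

definition gls_family :: "nat set \<Rightarrow> (nat \<Rightarrow> real) \<Rightarrow> (nat \<Rightarrow> real) \<Rightarrow> bool" where
  "gls_family D l r \<longleftrightarrow>
     (\<forall>n\<in>D. {l n..<r n} \<noteq> {} \<and> {l n..<r n} \<subseteq> {0..1}) \<and>
     disjoint_family_on (\<lambda>n. {l n..<r n}) D \<and>
     ((\<lambda>n. r n - l n) has_sum 1) D"

text \<open>
  On \<open>[l n, r n)\<close> the map is the affine bijection onto \<open>[0, 1)\<close> that sends \<open>l n\<close> to 0
  if \<open>\<epsilon> n = 0\<close>, and the one onto \<open>(0, 1]\<close> that sends \<open>l n\<close> to 1 if \<open>\<epsilon> n = 1\<close>.
  Only its values on \<open>[0, 1]\<close> matter.
\<close>

definition gls_map ::
  "nat set \<Rightarrow> (nat \<Rightarrow> real) \<Rightarrow> (nat \<Rightarrow> real) \<Rightarrow> (nat \<Rightarrow> nat) \<Rightarrow> real \<Rightarrow> real" where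
  "gls_map D l r \<epsilon> x =
     (if \<exists>n\<in>D. x \<in> {l n..<r n}
      then (let n = (THE n. n \<in> D \<and> x \<in> {l n..<r n})
            in if \<epsilon> n = 0 then (x - l n) / (r n - l n) else (r n - x) / (r n - l n))
      else 0)"

section \<open>Invariant measures, generating points and irregular points\<close>

definition unit_borel_prob :: "real measure \<Rightarrow> bool" where
  "unit_borel_prob \<mu> \<longleftrightarrow> prob_space \<mu> \<and> sets \<mu> = sets (restrict_space borel {0..1})"

definition unit_invariant :: "(real \<Rightarrow> real) \<Rightarrow> real measure \<Rightarrow> bool" where
  "unit_invariant T \<mu> \<longleftrightarrow> (\<forall>B\<in>sets \<mu>. emeasure \<mu> B = emeasure \<mu> (T -` B \<inter> {0..1}))"

definition visit_freq :: "('a \<Rightarrow> 'a) \<Rightarrow> 'a \<Rightarrow> 'a set \<Rightarrow> nat \<Rightarrow> real" where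
  "visit_freq T x A N = real (card {n. n < N \<and> (T ^^ n) x \<in> A}) / real N"

definition generates :: "(real \<Rightarrow> real) \<Rightarrow> real \<Rightarrow> real measure \<Rightarrow> bool" where
  "generates T x \<mu> \<longleftrightarrow>
     (\<forall>I. is_interval I \<and> I \<subseteq> {0..1} \<and> measure \<mu> (unit_top frontier_of I) = 0 \<longrightarrow>
        visit_freq T x I \<longlonglongrightarrow> measure \<mu> I)"

text \<open>The list \<open>as\<close> is indexed from 0, so \<open>as ! j\<close> is the digit read off at time \<open>j\<close>.\<close>

definition gls_cylinder ::
  "nat set \<Rightarrow> (nat \<Rightarrow> real) \<Rightarrow> (nat \<Rightarrow> real) \<Rightarrow> (nat \<Rightarrow> nat) \<Rightarrow> nat list \<Rightarrow> real set" where
  "gls_cylinder D l r \<epsilon> as =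
     {y \<in> {0..1}. \<forall>j<length as. (gls_map D l r \<epsilon> ^^ j) y \<in> {l (as ! j)..<r (as ! j)}}"

definition gls_irregular ::
  "nat set \<Rightarrow> (nat \<Rightarrow> real) \<Rightarrow> (nat \<Rightarrow> real) \<Rightarrow> (nat \<Rightarrow> nat) \<Rightarrow> real \<Rightarrow> bool" where
  "gls_irregular D l r \<epsilon> x \<longleftrightarrow>
     (\<exists>as. as \<noteq> [] \<and> set as \<subseteq> D \<and>
        \<not> convergent (visit_freq (gls_map D l r \<epsilon>) x (gls_cylinder D l r \<epsilon> as)))"

end

theory Submission
  imports Defs "HOL-Library.Discrete_Functions" "HOL-Real_Asymp.Real_Asymp"
begin

text \<open>
  A set \<open>A\<close> is not \<open>\<Sigma>\<^sup>0\<^sub>3\<close> as soon as there is a continuous map \<open>f\<close> from the Baire space with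
  \<open>f z \<in> A\<close> iff \<open>z\<close> tends to infinity; this is a direct Baire category argument. Both halves of the
  theorem use the same map. Start from a digit sequence \<open>G\<close> in which all words have limiting
  frequencies, and overwrite it by a constant digit \<open>a\<close> on the windows
  \<open>[4 ^ k + 3, 4 ^ k + 4 ^ k / (z k + 1))\<close>. If \<open>z\<close> tends to infinity, the overwritten positions have
  density 0 and no frequency changes. Otherwise the frequency of \<open>a\<close> diverges, unless it was 1.
  For the irregular points \<open>G\<close> may be constant. For the points that generate \<open>\<mu>\<close>, the sequence \<open>G\<close>
  has to be generic for \<open>\<mu>\<close>, which need not be ergodic; \<open>G\<close> is pieced together from
  orbit segments of increasing length whose starting points are chosen greedily.

  Points whose orbit meets the endpoint of a digit interval are eventually periodic and hence regular,
  and they generate no measure without an atom at 0. The other points form a \<open>G\<^sub>\<delta>\<close> set on which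
  every iterate of the map is continuous, which gives the upper bounds.
\<close>

section \<open>Sets that are not \<open>\<Sigma>\<^sup>0\<^sub>3\<close>\<close>

text \<open>A digit sequence codes a point as a limit of inverse branches, but the intervals are
  half-open, so that this point need not have the sequence as its itinerary. This can fail only if
  some tail codes 0 or 1. The map sends \<open>{0, 1}\<close> to itself, so such a tail is
  eventually periodic with period dividing 2. Two different digits planted at distance 2, at sparse
  positions, exclude this for all \<open>z\<close> at once. Powers of 4 leave the stretch from
  \<open>2 * 4 ^ k\<close> to \<open>4 * 4 ^ k\<close> free of windows. It is a fixed fraction of
  its right end, so a limiting frequency must show there as well as on the windows with bounded
  \<open>z k\<close>; comparing the two gives divergence. For a measure that is not ergodic, the
  averages along a typical orbit tend to a conditional expectation, so a single orbit may fail to be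
  generic. The pieces lie between consecutive squares: they grow, so words that cross a boundary
  have density 0, and they are short enough that a discrepancy of order
  \<open>m powr (3 / 2)\<close> after \<open>m\<close> pieces is negligible against the length
  \<open>m ^ 2\<close>.\<close>

lemma gdelta_in_iff_Inter:
  "gdelta_in X S \<longleftrightarrow> (\<exists>C::nat \<Rightarrow> _. (\<forall>n. openin X (C n)) \<and> S = \<Inter>(range C))"
proof
  assume "gdelta_in X S"
  then show "\<exists>C::nat \<Rightarrow> _. (\<forall>n. openin X (C n)) \<and> S = \<Inter>(range C)"
    unfolding gdelta_in_descending by blast
next
  assume "\<exists>C::nat \<Rightarrow> _. (\<forall>n. openin X (C n)) \<and> S = \<Inter>(range C)"
  then obtain C :: "nat \<Rightarrow> 'a set" where "\<And>n. openin X (C n)" "S = \<Inter>(range C)"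
    by blast
  then show "gdelta_in X S"
    using gdelta_in_Inter[of "range C" X] open_imp_gdelta_in by fastforce
qed

lemma borel_Pi_2_iff: "S \<in> borel_Pi X 2 \<longleftrightarrow> gdelta_in X S"
proof
  assume "S \<in> borel_Pi X 2"
  then obtain A :: "nat \<Rightarrow> 'a set" where A: "range A \<subseteq> (\<lambda>S. topspace X - S) ` borel_Sigma X 1"
    and S: "S = topspace X - \<Union>(range A)"
    by (auto simp: borel_Pi_def numeral_2_eq_2)
  have "closedin X (A n)" for n
  proof -
    have "A n \<in> (\<lambda>S. topspace X - S) ` borel_Sigma X 1"
      using A by auto
    then show ?thesis by (auto simp: openin_subset closedin_def Diff_Diff_Int Int_absorb1)
  qed
  then have "fsigma_in X (\<Union>(range A))"
    using fsigma_in_Union[of "range A" X] closed_imp_fsigma_in by fastforce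
  then show "gdelta_in X S"
    unfolding S by (rule gdelta_in_diff[OF gdelta_in_topspace])
next
  assume "gdelta_in X S"
  then obtain C :: "nat \<Rightarrow> 'a set" where C: "\<And>n. openin X (C n)" and S: "S = \<Inter>(range C)"
    unfolding gdelta_in_iff_Inter by blast
  have sub: "S \<subseteq> topspace X"
    using openin_subset[OF C] S by blast
  define A where "A n = topspace X - C n" for n
  have "range A \<subseteq> (\<lambda>S. topspace X - S) ` borel_Sigma X 1"
    using C by (auto simp: A_def)
  then have "\<Union>(range A) \<in> borel_Sigma X 2"
    by (auto simp: numeral_2_eq_2)
  moreover have "S = topspace X - \<Union>(range A)"
    using sub S by (auto simp: A_def)
  ultimately show "S \<in> borel_Pi X 2"
    unfolding borel_Pi_def by blast
qed

lemma borel_Sigma_3_iff: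
  "S \<in> borel_Sigma X 3 \<longleftrightarrow> (\<exists>A::nat \<Rightarrow> _. (\<forall>n. gdelta_in X (A n)) \<and> S = \<Union>(range A))"
proof -
  have "S \<in> borel_Sigma X 3 \<longleftrightarrow> (\<exists>A::nat \<Rightarrow> _. range A \<subseteq> borel_Pi X 2 \<and> S = \<Union>(range A))"
    by (auto simp: numeral_3_eq_3 numeral_2_eq_2 borel_Pi_def)
  then show ?thesis
    by (simp add: image_subset_iff borel_Pi_2_iff)
qed

lemma borel_Sigma_3I:
  assumes "countable \<F>" "\<And>A. A \<in> \<F> \<Longrightarrow> gdelta_in X A"
  shows "\<Union>\<F> \<in> borel_Sigma X 3"
proof -
  have "countable (insert {} \<F>)" "insert {} \<F> \<noteq> {}"
    using assms by auto
  then obtain f :: "nat \<Rightarrow> 'a set" where f: "range f = insert {} \<F>"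
    by (metis range_from_nat_into)
  have "gdelta_in X (f n)" for n
  proof -
    have "f n \<in> insert {} \<F>"
      using f by blast
    then show ?thesis
      using assms(2) by auto
  qed
  moreover have "\<Union>\<F> = \<Union>(range f)"
    using f by auto
  ultimately show ?thesis
    unfolding borel_Sigma_3_iff by blast
qed

lemma prefix_limit:
  fixes t :: "nat \<Rightarrow> nat \<Rightarrow> 'a"
  assumes len: "\<And>j. N j < N (Suc j)" and ext: "\<And>i j. i < N j \<Longrightarrow> t (Suc j) i = t j i"
  obtains u where "\<And>i j. i < N j \<Longrightarrow> u i = t j i"
proof
  have mono: "strict_mono N"
    by (rule strict_monoI_Suc) (rule len)
  have ext_le: "t (j + d) i = t j i" if "i < N j" for i j d
  proof (induction d)
    case (Suc d)
    have "i < N (j + d)"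
      using that strict_mono_leD[OF mono, of j "j + d"] by simp
    then show ?case
      using Suc ext by simp
  qed simp
  \<comment> \<open>The limit is the diagonal \<open>\<lambda>i. t (Suc i) i\<close>: as
    \<open>N\<close> is strictly increasing, \<open>i < N (Suc i)\<close>, and stage
    \<open>Suc i\<close> has already fixed entry \<open>i\<close>.\<close>
  show "t (Suc i) i = t j i" if "i < N j" for i j
  proof -
    have "i < N (Suc i)"
      using strict_mono_imp_increasing[OF mono, of "Suc i"] by simp
    then show ?thesis
      using ext_le[of i j "Suc i - j"] ext_le[of i "Suc i" "j - Suc i"] that
      by (cases "j \<le> Suc i") auto
  qed
qed

text \<open>
  Inside the closed set of sequences that extend a given prefix by entries \<open>\<ge> k\<close>, the sequences that
  take the value \<open>k\<close> infinitely often form a dense \<open>G\<^sub>\<delta>\<close> set.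
\<close>

lemma avoid_gdelta:
  fixes P :: "nat \<Rightarrow> (nat \<Rightarrow> nat) \<Rightarrow> bool"
  assumes opn: "\<And>j z. P j z \<Longrightarrow> \<exists>n. \<forall>z'. (\<forall>i<n. z' i = z i) \<longrightarrow> P j z'"
    and lim: "\<And>z. (\<And>j. P j z) \<Longrightarrow> filterlim z at_top sequentially"
  obtains s' n' where "n < n'" "\<forall>i<n. s' i = s i" "\<forall>i\<in>{n..<n'}. k \<le> s' i"
    "\<And>z. \<forall>i<n'. z i = s' i \<Longrightarrow> \<forall>i\<ge>n'. k \<le> z i \<Longrightarrow> \<exists>j. \<not> P j z"
proof -
  have "\<exists>s' n'. n < n' \<and> (\<forall>i<n. s' i = s i) \<and> (\<forall>i\<in>{n..<n'}. k \<le> s' i) \<and>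
      (\<forall>z. (\<forall>i<n'. z i = s' i) \<longrightarrow> (\<forall>i\<ge>n'. k \<le> z i) \<longrightarrow> (\<exists>j. \<not> P j z))"
  proof (rule ccontr)
    assume neg: "\<not> ?thesis"
    \<comment> \<open>If the lemma fails, the intersection of the \<open>P j\<close> is dense among
      the admissible sequences. A Baire construction then secures all \<open>P j\<close> while
      writing the value \<open>k\<close> infinitely often, against \<open>lim\<close>.\<close>
    have dense: "\<exists>z. (\<forall>i<n'. z i = s' i) \<and> (\<forall>i\<ge>n'. k \<le> z i) \<and> (\<forall>j. P j z)"
      if "n < n'" "\<forall>i<n. s' i = s i" "\<forall>i\<in>{n..<n'}. k \<le> s' i" for s' n'
    proof -
      have "\<not> (n < n' \<and> (\<forall>i<n. s' i = s i) \<and> (\<forall>i\<in>{n..<n'}. k \<le> s' i) \<and>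
          (\<forall>z. (\<forall>i<n'. z i = s' i) \<longrightarrow> (\<forall>i\<ge>n'. k \<le> z i) \<longrightarrow> (\<exists>j. \<not> P j z)))"
        using neg by simp
      then show ?thesis
        using that by blast
    qed
    define Q :: "nat \<Rightarrow> (nat \<Rightarrow> nat) \<times> nat \<Rightarrow> bool" where
      "Q j = (\<lambda>(t, m). n < m \<and> (\<forall>i<n. t i = s i) \<and> (\<forall>i\<in>{n..<m}. k \<le> t i))" for j
    define R :: "nat \<Rightarrow> (nat \<Rightarrow> nat) \<times> nat \<Rightarrow> (nat \<Rightarrow> nat) \<times> nat \<Rightarrow> bool" where
      "R j = (\<lambda>(t, m) (t', m'). m < m' \<and> (\<forall>i<m. t' i = t i) \<and> t' m = k \<and>
         (\<forall>z. (\<forall>i<m'. z i = t' i) \<longrightarrow> P j z))" for j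
    have "\<exists>x. Q 0 x"
      by (rule exI[of _ "(s(n := k), Suc n)"]) (auto simp: Q_def)
    \<comment> \<open>One stage: append \<open>k\<close>, take from \<open>dense\<close> a sequence
      beyond it that satisfies every \<open>P j\<close>, and keep so much of it that
      \<open>P j\<close> is secured. The \<open>max\<close> keeps the appended entry inside the new
      prefix.\<close>
    moreover have "\<exists>y. Q (Suc j) y \<and> R j x y" if x: "Q j x" for j x
    proof -
      obtain t m where [simp]: "x = (t, m)"
        by fastforce
      have "\<forall>i\<in>{n..<Suc m}. k \<le> (t(m := k)) i"
        using x by (auto simp: Q_def less_Suc_eq)
      then obtain z where z: "\<forall>i<Suc m. z i = (t(m := k)) i" "\<forall>i\<ge>Suc m. k \<le> z i" "\<forall>j. P j z"
        using dense[of "Suc m" "t(m := k)"] x by (auto simp: Q_def)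
      obtain m' where m': "\<forall>z'. (\<forall>i<m'. z' i = z i) \<longrightarrow> P j z'"
        using opn z(3) by blast
      have "k \<le> z i" if "i \<ge> n" for i
        using that z x by (cases "i < m"; cases "i = m") (auto simp: Q_def)
      then have "Q (Suc j) (z, max (Suc m) m') \<and> R j x (z, max (Suc m) m')"
        using z m' x by (auto simp: Q_def R_def)
      then show ?thesis by blast
    qed
    ultimately obtain f where f: "\<And>j. Q j (f j)" "\<And>j. R j (f j) (f (Suc j))"
      using dependent_nat_choice[of Q R] by blast
    define t where "t j = fst (f j)" for j
    define N where "N j = snd (f j)" for j
    have R: "N j < N (Suc j)" "\<And>i. i < N j \<Longrightarrow> t (Suc j) i = t j i" "t (Suc j) (N j) = k"
      "\<And>z. \<forall>i<N (Suc j). z i = t (Suc j) i \<Longrightarrow> P j z" for j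
      using f(2)[of j] by (auto simp: R_def t_def N_def split_beta)
    obtain u where u: "\<And>i j. i < N j \<Longrightarrow> u i = t j i"
      using prefix_limit[of N t] R(1,2) by blast
    have "P j u" for j
      using R(4)[of j u] u by blast
    then have "filterlim u at_top sequentially"
      by (rule lim)
    then obtain m where m: "\<And>i. i \<ge> m \<Longrightarrow> Suc k \<le> u i"
      unfolding filterlim_at_top eventually_sequentially by blast
    have "m \<le> N m"
      by (rule strict_mono_imp_increasing) (auto intro: strict_monoI_Suc R)
    moreover have "u (N m) = k"
      using u[of "N m" "Suc m"] R by simp
    ultimately show False
      using m[of "N m"] by simp
  qed
  then show ?thesis
    using that by blast
qed

text \<open>Stage \<open>k\<close> leaves the \<open>k\<close>-th intersection for good by
  \<open>avoid_gdelta\<close>, at the price of keeping all later entries \<open>\<ge> k\<close>.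
  These promises are compatible, and together they make the limit sequence tend to infinity although
  it lies in none of the intersections.\<close>

lemma tendsto_infinity_not_Union_gdelta:
  fixes P :: "nat \<Rightarrow> nat \<Rightarrow> (nat \<Rightarrow> nat) \<Rightarrow> bool"
  assumes opn: "\<And>k j z. P k j z \<Longrightarrow> \<exists>n. \<forall>z'. (\<forall>i<n. z' i = z i) \<longrightarrow> P k j z'"
    and iff: "\<And>z. filterlim z at_top sequentially \<longleftrightarrow> (\<exists>k. \<forall>j. P k j z)"
  shows False
proof -
  define R :: "nat \<Rightarrow> (nat \<Rightarrow> nat) \<times> nat \<Rightarrow> (nat \<Rightarrow> nat) \<times> nat \<Rightarrow> bool" where
    "R k = (\<lambda>(t, m) (t', m'). m < m' \<and> (\<forall>i<m. t' i = t i) \<and> (\<forall>i\<in>{m..<m'}. k \<le> t' i) \<and>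
       (\<forall>z. (\<forall>i<m'. z i = t' i) \<longrightarrow> (\<forall>i\<ge>m'. k \<le> z i) \<longrightarrow> (\<exists>j. \<not> P k j z)))" for k
  have "\<exists>y. True \<and> R k x y" for k x
  proof -
    obtain t m where [simp]: "x = (t, m)"
      by fastforce
    show ?thesis
      by (rule avoid_gdelta[of "P k" m t k]) (use opn iff in \<open>auto simp: R_def\<close>)
  qed
  then obtain f where f: "\<And>k. R k (f k) (f (Suc k))"
    using dependent_nat_choice[of "\<lambda>_ _. True" R] by blast
  define t where "t j = fst (f j)" for j
  define N where "N j = snd (f j)" for j
  have R: "N k < N (Suc k)" "\<And>i. i < N k \<Longrightarrow> t (Suc k) i = t k i"
    "\<And>i. N k \<le> i \<Longrightarrow> i < N (Suc k) \<Longrightarrow> k \<le> t (Suc k) i"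
    "\<And>z. \<forall>i<N (Suc k). z i = t (Suc k) i \<Longrightarrow> \<forall>i\<ge>N (Suc k). k \<le> z i \<Longrightarrow> \<exists>j. \<not> P k j z" for k
    using f[of k] by (auto simp: R_def t_def N_def split_beta)
  obtain u where u: "\<And>i j. i < N j \<Longrightarrow> u i = t j i"
    using prefix_limit[of N t] R(1,2) by blast
  have mono: "strict_mono N"
    by (rule strict_monoI_Suc) (rule R)
  have ge: "k \<le> u i" if "N k \<le> i" for k i
  proof -
    \<comment> \<open>The first prefix that covers entry \<open>i\<close> tells at which stage the
      entry was written, and stage \<open>m'\<close> writes only values
      \<open>\<ge> m'\<close>.\<close>
    define m where "m = (LEAST m. i < N m)"
    have "i < N (Suc i)"
      using strict_mono_imp_increasing[OF mono, of "Suc i"] by simp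
    then have m: "i < N m"
      unfolding m_def by (rule LeastI)
    then have "N k < N m"
      using that by simp
    then have "k < m"
      using mono by (simp add: strict_mono_less)
    then obtain m' where [simp]: "m = Suc m'"
      using less_imp_Suc_add by blast
    have "\<not> i < N m'"
      using not_less_Least[of m' "\<lambda>m. i < N m"] m_def by simp
    then have "m' \<le> t m i"
      using R(3)[of m' i] m by simp
    also have "t m i = u i"
      using u m by simp
    finally show ?thesis
      using \<open>k < m\<close> by simp
  qed
  have "filterlim u at_top sequentially"
    unfolding filterlim_at_top eventually_sequentially using ge by blast
  moreover have "\<exists>j. \<not> P k j u" for k
  proof (rule R(4))
    show "\<forall>i<N (Suc k). u i = t (Suc k) i"
      using u by blast
    show "\<forall>i\<ge>N (Suc k). k \<le> u i"
      using ge R(1)[of k] by (meson less_imp_le order_trans)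
  qed
  ultimately show False
    using iff by blast
qed

text \<open>\<open>cont\<close> is continuity on the Baire space expressed by prefixes, so a
  countable union of \<open>G\<^sub>\<delta>\<close> sets equal to \<open>A\<close> pulls back to
  one equal to the set of sequences tending to infinity.\<close>

proposition not_Sigma3_if_reduces_tendsto_infinity:
  fixes f :: "(nat \<Rightarrow> nat) \<Rightarrow> 'a"
  assumes cont: "\<And>U z. openin X U \<Longrightarrow> f z \<in> U \<Longrightarrow> \<exists>n. \<forall>z'. (\<forall>i<n. z' i = z i) \<longrightarrow> f z' \<in> U"
    and iff: "\<And>z. f z \<in> A \<longleftrightarrow> filterlim z at_top sequentially"
  shows "A \<notin> borel_Sigma X 3"
proof
  assume "A \<in> borel_Sigma X 3"
  then obtain B :: "nat \<Rightarrow> 'a set" where B: "\<forall>n. gdelta_in X (B n)" "A = \<Union>(range B)"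
    unfolding borel_Sigma_3_iff by blast
  then obtain C :: "nat \<Rightarrow> nat \<Rightarrow> 'a set" where C: "\<And>n k. openin X (C n k)" "\<And>n. B n = \<Inter>(range (C n))"
    unfolding gdelta_in_iff_Inter by metis
  show False
  proof (rule tendsto_infinity_not_Union_gdelta)
    show "\<exists>n. \<forall>z'. (\<forall>i<n. z' i = z i) \<longrightarrow> f z' \<in> C k j" if "f z \<in> C k j" for k j z
      using cont[OF C(1) that] .
    show "filterlim z at_top sequentially \<longleftrightarrow> (\<exists>k. \<forall>j. f z \<in> C k j)" for z
      unfolding iff[symmetric] B C by blast
  qed
qed

section \<open>Frequencies\<close>

definition freq :: "(nat \<Rightarrow> bool) \<Rightarrow> nat \<Rightarrow> real" where
  "freq P N = real (card {n. n < N \<and> P n}) / real N"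

text \<open>Along an itinerary this is a visit of the \<open>n\<close>-th iterate to the cylinder of
  \<open>w\<close>, see \<open>follows_in_cyl_iff\<close>; frequency questions thus pass from orbits
  to digit sequences.\<close>

definition occurs :: "'a list \<Rightarrow> (nat \<Rightarrow> 'a) \<Rightarrow> nat \<Rightarrow> bool" where
  "occurs w s n \<longleftrightarrow> (\<forall>j<length w. s (n + j) = w ! j)"

lemma visit_freq_eq_freq: "visit_freq T x A = freq (\<lambda>n. (T ^^ n) x \<in> A)"
  by (simp add: fun_eq_iff visit_freq_def freq_def)

lemma freq_nonneg: "0 \<le> freq P N"
  by (simp add: freq_def)

lemma freq_mono: "(\<And>n. n < N \<Longrightarrow> P n \<Longrightarrow> Q n) \<Longrightarrow> freq P N \<le> freq Q N"
  unfolding freq_def by (intro divide_right_mono of_nat_mono card_mono) auto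

lemma freq_disj_le: "freq (\<lambda>n. P n \<or> Q n) N \<le> freq P N + freq Q N"
proof -
  have "{n. n < N \<and> (P n \<or> Q n)} = {n. n < N \<and> P n} \<union> {n. n < N \<and> Q n}"
    by auto
  then show ?thesis
    unfolding freq_def add_divide_distrib[symmetric]
    by (intro divide_right_mono) (simp_all flip: of_nat_add add: card_Un_le)
qed

lemma freq_not: "N > 0 \<Longrightarrow> freq (\<lambda>n. \<not> P n) N = 1 - freq P N"
proof -
  assume "N > 0"
  have "{..<N} = {n. n < N \<and> \<not> P n} \<union> {n. n < N \<and> P n}"
    by auto
  then have "card {..<N} = card {n. n < N \<and> \<not> P n} + card {n. n < N \<and> P n}"
    by (subst \<open>{..<N} = _\<close>, intro card_Un_disjoint) auto
  then have "real N = real (card {n. n < N \<and> \<not> P n}) + real (card {n. n < N \<and> P n})"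
    by simp
  with \<open>N > 0\<close> show ?thesis
    by (simp add: freq_def field_simps)
qed

lemma freq_bex_disjoint:
  assumes "finite F" "\<And>n i j. i \<in> F \<Longrightarrow> j \<in> F \<Longrightarrow> P i n \<Longrightarrow> P j n \<Longrightarrow> i = j"
  shows "freq (\<lambda>n. \<exists>i\<in>F. P i n) N = (\<Sum>i\<in>F. freq (P i) N)"
proof -
  have "{n. n < N \<and> (\<exists>i\<in>F. P i n)} = (\<Union>i\<in>F. {n. n < N \<and> P i n})"
    by auto
  moreover have "card (\<Union>i\<in>F. {n. n < N \<and> P i n}) = (\<Sum>i\<in>F. card {n. n < N \<and> P i n})"
    using assms by (intro card_UN_disjoint) auto
  ultimately show ?thesis
    by (simp add: freq_def sum_divide_distrib)
qed

lemma abs_freq_diff_le: "\<bar>freq P N - freq Q N\<bar> \<le> freq (\<lambda>n. P n \<noteq> Q n) N"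
proof -
  have "freq P N \<le> freq (\<lambda>n. Q n \<or> P n \<noteq> Q n) N" "freq Q N \<le> freq (\<lambda>n. P n \<or> P n \<noteq> Q n) N"
    by (auto intro: freq_mono)
  then show ?thesis
    using freq_disj_le[of Q "\<lambda>n. P n \<noteq> Q n" N] freq_disj_le[of P "\<lambda>n. P n \<noteq> Q n" N] by simp
qed

lemma freq_null_mono:
  assumes "freq Q \<longlonglongrightarrow> 0" "\<And>n. P n \<Longrightarrow> Q n"
  shows "freq P \<longlonglongrightarrow> 0"
  by (rule tendsto_sandwich[OF _ _ tendsto_const assms(1)])
     (auto intro!: always_eventually freq_mono assms freq_nonneg)

lemma freq_null_disj:
  assumes "freq P \<longlonglongrightarrow> 0" "freq Q \<longlonglongrightarrow> 0"
  shows "freq (\<lambda>n. P n \<or> Q n) \<longlonglongrightarrow> 0"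
proof (rule tendsto_sandwich[OF _ _ tendsto_const])
  show "(\<lambda>N. freq P N + freq Q N) \<longlonglongrightarrow> 0"
    using tendsto_add[OF assms] by simp
qed (auto intro!: always_eventually freq_disj_le freq_nonneg)

lemma freq_tendsto_cong_null:
  assumes "freq P \<longlonglongrightarrow> \<theta>" "freq (\<lambda>n. P n \<noteq> Q n) \<longlonglongrightarrow> 0"
  shows "freq Q \<longlonglongrightarrow> \<theta>"
proof -
  have "(\<lambda>N. freq P N - freq Q N) \<longlonglongrightarrow> 0"
    by (rule Lim_null_comparison[OF _ assms(2)])
       (use abs_freq_diff_le[of P _ Q] in \<open>auto intro: always_eventually\<close>)
  from tendsto_diff[OF assms(1) this] show ?thesis
    by simp
qed

lemma freq_null_shift:
  assumes "freq P \<longlonglongrightarrow> 0"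
  shows "freq (\<lambda>n. P (n + j)) \<longlonglongrightarrow> 0"
proof (rule tendsto_sandwich[OF _ _ tendsto_const])
  show "\<forall>\<^sub>F N in sequentially. freq (\<lambda>n. P (n + j)) N \<le> freq P N + real j / real N"
  proof (rule always_eventually, rule allI)
    fix N
    have "card {n. n < N \<and> P (n + j)} = card ((\<lambda>n. n + j) ` {n. n < N \<and> P (n + j)})"
      by (simp add: card_image)
    also have "\<dots> \<le> card ({n. n < N \<and> P n} \<union> {N..<N + j})"
      by (rule card_mono) auto
    also have "\<dots> \<le> card {n. n < N \<and> P n} + j"
      using card_Un_le[of "{n. n < N \<and> P n}" "{N..<N + j}"] by simp
    finally have "real (card {n. n < N \<and> P (n + j)}) \<le> real (card {n. n < N \<and> P n}) + real j"
      by linarith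
    then show "freq (\<lambda>n. P (n + j)) N \<le> freq P N + real j / real N"
      unfolding freq_def add_divide_distrib[symmetric] by (rule divide_right_mono) simp
  qed
  show "(\<lambda>N. freq P N + real j / real N) \<longlonglongrightarrow> 0"
    using tendsto_add[OF assms lim_const_over_n[of "real j"]] by simp
qed (simp add: freq_nonneg)

lemma freq_null_bex_shift:
  assumes "freq P \<longlonglongrightarrow> 0"
  shows "freq (\<lambda>n. \<exists>j<k. P (n + j)) \<longlonglongrightarrow> 0"
proof (induction k)
  case 0
  then show ?case by (simp add: freq_def)
next
  case (Suc k)
  have "freq (\<lambda>n. P (n + k) \<or> (\<exists>j<k. P (n + j))) \<longlonglongrightarrow> 0"
    by (rule freq_null_disj[OF freq_null_shift[OF assms] Suc])
  then show ?case
    by (simp add: Ex_less_Suc)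
qed

text \<open>An occurrence at \<open>n\<close> is affected only by changes at the
  \<open>length w\<close> positions from \<open>n\<close> on, and finitely many shifts of a set of
  density 0 still have density 0.\<close>

lemma freq_occurs_cong_null:
  assumes "freq (occurs w s) \<longlonglongrightarrow> \<theta>" "freq (\<lambda>n. s n \<noteq> s' n) \<longlonglongrightarrow> 0"
  shows "freq (occurs w s') \<longlonglongrightarrow> \<theta>"
  by (rule freq_tendsto_cong_null[OF assms(1)],
      rule freq_null_mono[OF freq_null_bex_shift[OF assms(2), of "length w"]])
     (auto simp: occurs_def)

text \<open>\<open>C\<close> may depend on \<open>e\<close>: it absorbs the initial positions where
  nothing small is known.\<close>

lemma freq_nullI:
  assumes "\<And>e. e > 0 \<Longrightarrow> \<exists>C. \<forall>N. real (card {n. n < N \<and> P n}) \<le> C + e * real N"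
  shows "freq P \<longlonglongrightarrow> 0"
proof (rule LIMSEQ_I)
  fix r :: real assume r: "0 < r"
  obtain C where C: "\<And>N. real (card {n. n < N \<and> P n}) \<le> C + r / 2 * real N"
    using assms[of "r / 2"] r by auto
  have "(\<lambda>N. C / real N) \<longlonglongrightarrow> 0"
    by (rule lim_const_over_n)
  then have "\<forall>\<^sub>F N in sequentially. C / real N < r / 2"
    using r by (intro order_tendstoD) auto
  then have "\<forall>\<^sub>F N in sequentially. norm (freq P N - 0) < r"
    using eventually_gt_at_top[of 0]
  proof eventually_elim
    case (elim N)
    have "freq P N \<le> (C + r / 2 * real N) / real N"
      unfolding freq_def using C by (rule divide_right_mono) simp
    also have "\<dots> = C / real N + r / 2"
      using elim by (simp add: field_simps)
    also have "\<dots> < r"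
      using elim(1) by linarith
    finally show ?case
      using freq_nonneg[of P N] by simp
  qed
  then show "\<exists>no. \<forall>n\<ge>no. norm (freq P n - 0) < r"
    by (simp add: eventually_sequentially)
qed

text \<open>The count in a window is a difference of two initial counts. As the window makes up at
  least the fraction \<open>1 / K\<close> of \<open>g k\<close>, the errors of the two initial
  frequencies grow at most by the factor \<open>K\<close>.\<close>

lemma freq_window:
  assumes P: "freq P \<longlonglongrightarrow> \<theta>" and f: "filterlim f at_top sequentially"
    and fg: "\<And>k. f k < g k" and K: "\<And>k. g k \<le> K * (g k - f k)"
  shows "(\<lambda>k. real (card {n. f k \<le> n \<and> n < g k \<and> P n}) / real (g k - f k)) \<longlonglongrightarrow> \<theta>"
    (is "?R \<longlonglongrightarrow> _")
proof -
  have g: "filterlim g at_top sequentially"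
    by (rule filterlim_at_top_mono[OF f]) (auto intro: always_eventually less_imp_le fg)
  have lim: "(\<lambda>k. freq P (f k) - \<theta>) \<longlonglongrightarrow> 0" "(\<lambda>k. freq P (g k) - \<theta>) \<longlonglongrightarrow> 0"
    using filterlim_compose[OF P f] filterlim_compose[OF P g] by (simp_all add: LIM_zero)
  have "(\<lambda>k. real K * (\<bar>freq P (g k) - \<theta>\<bar> + \<bar>freq P (f k) - \<theta>\<bar>)) \<longlonglongrightarrow> real K * (\<bar>0\<bar> + \<bar>0\<bar>)"
    by (intro tendsto_intros lim)
  then have "(\<lambda>k. real K * (\<bar>freq P (g k) - \<theta>\<bar> + \<bar>freq P (f k) - \<theta>\<bar>)) \<longlonglongrightarrow> 0"
    by simp
  moreover have "norm (?R k - \<theta>) \<le> real K * (\<bar>freq P (g k) - \<theta>\<bar> + \<bar>freq P (f k) - \<theta>\<bar>)" for k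
  proof -
    let ?f = "real (f k)" and ?g = "real (g k)"
    have "{n. n < g k \<and> P n} = {n. n < f k \<and> P n} \<union> {n. f k \<le> n \<and> n < g k \<and> P n}"
      using fg[of k] by auto
    moreover have "card ({n. n < f k \<and> P n} \<union> {n. f k \<le> n \<and> n < g k \<and> P n}) =
        card {n. n < f k \<and> P n} + card {n. f k \<le> n \<and> n < g k \<and> P n}"
      by (intro card_Un_disjoint) auto
    ultimately have "card {n. n < g k \<and> P n} =
        card {n. n < f k \<and> P n} + card {n. f k \<le> n \<and> n < g k \<and> P n}"
      by (simp only:)
    moreover have "real (card {n. n < m \<and> P n}) = freq P m * real m" for m
      by (cases "m = 0") (auto simp: freq_def)
    ultimately have *: "real (card {n. f k \<le> n \<and> n < g k \<and> P n}) =
        freq P (g k) * ?g - freq P (f k) * ?f"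
      by (metis add_diff_cancel_left' of_nat_add)
    have d: "?g - ?f > 0" "real (g k - f k) = ?g - ?f"
      using fg[of k] by (simp_all add: of_nat_diff)
    have "?g \<le> real (K * (g k - f k))"
      using K[of k] by (simp only: of_nat_le_iff)
    then have gK: "?g \<le> real K * (?g - ?f)"
      using d by simp
    have "?R k - \<theta> = ((freq P (g k) - \<theta>) * ?g - (freq P (f k) - \<theta>) * ?f) / (?g - ?f)"
      unfolding * d using d by (simp add: field_simps)
    also have "\<bar>\<dots>\<bar> \<le> (\<bar>freq P (g k) - \<theta>\<bar> * ?g + \<bar>freq P (f k) - \<theta>\<bar> * ?g) / (?g - ?f)"
    proof -
      have "\<bar>freq P (f k) - \<theta>\<bar> * ?f \<le> \<bar>freq P (f k) - \<theta>\<bar> * ?g"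
        using fg[of k] by (intro mult_left_mono) auto
      moreover have "\<bar>(freq P (g k) - \<theta>) * ?g - (freq P (f k) - \<theta>) * ?f\<bar> \<le>
          \<bar>freq P (g k) - \<theta>\<bar> * ?g + \<bar>freq P (f k) - \<theta>\<bar> * ?f"
        by (rule order_trans[OF abs_triangle_ineq4]) (simp add: abs_mult)
      ultimately show ?thesis
        using d by (simp add: abs_divide divide_right_mono)
    qed
    also have "\<dots> = (\<bar>freq P (g k) - \<theta>\<bar> + \<bar>freq P (f k) - \<theta>\<bar>) * (?g / (?g - ?f))"
      by (simp add: field_simps)
    also have "\<dots> \<le> (\<bar>freq P (g k) - \<theta>\<bar> + \<bar>freq P (f k) - \<theta>\<bar>) * real K"
      using gK d by (intro mult_left_mono) (auto simp: divide_simps)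
    finally show ?thesis
      by (simp add: mult.commute)
  qed
  ultimately have "(\<lambda>k. ?R k - \<theta>) \<longlonglongrightarrow> 0"
    by (rule_tac Lim_null_comparison) (auto intro: always_eventually)
  then show ?thesis
    by (simp add: LIM_zero_cancel)
qed

text \<open>Period 2 is that of orbits inside \<open>{0, 1}\<close>, see \<open>T_01\<close>. With
  \<open>c\<close> hits per period, the count stays within 2 of a line of slope
  \<open>c / 2\<close>.\<close>

lemma freq_eventually_periodic_convergent:
  assumes "\<And>n. n \<ge> n0 \<Longrightarrow> P (n + 2) \<longleftrightarrow> P n"
  shows "convergent (freq P)"
proof -
  define C where "C N = real (card {n. n < N \<and> P n})" for N
  have CS: "C (Suc N) = C N + of_bool (P N)" for N
  proof -
    have "{n. n < Suc N \<and> P n} = (if P N then insert N {n. n < N \<and> P n} else {n. n < N \<and> P n})"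
      by (auto simp: less_Suc_eq)
    then show ?thesis
      by (auto simp: C_def)
  qed
  define c :: real where "c = of_bool (P n0) + of_bool (P (Suc n0))"
  have per: "of_bool (P N) + of_bool (P (Suc N)) = c" if "N \<ge> n0" for N
    using that
  proof (induction N rule: dec_induct)
    case (step N)
    then show ?case
      using assms[of N] by simp
  qed (simp add: c_def)
  have bound: "\<bar>C N - C n0 - c / 2 * (real N - real n0)\<bar> \<le> 2" if "N \<ge> n0" for N
  proof -
    have *: "C (n0 + 2 * k) - C n0 = c * real k" for k
    proof (induction k)
      case (Suc k)
      have "C (n0 + 2 * Suc k) = C (n0 + 2 * k) + c"
        using CS per[of "n0 + 2 * k"] by (simp add: add.assoc)
      then show ?case
        using Suc by (simp add: algebra_simps)
    qed simp
    have c: "0 \<le> c" "c \<le> 2"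
      by (auto simp: c_def)
    define k where "k = (N - n0) div 2"
    have "N = n0 + 2 * k \<or> N = Suc (n0 + 2 * k)"
      using that unfolding k_def by presburger
    then have "c / 2 * (real N - real n0) = c * real k \<and> C N = C (n0 + 2 * k) \<or>
        c / 2 * (real N - real n0) = c * real k + c / 2 \<and> C N = C (Suc (n0 + 2 * k))"
      by (auto simp: field_simps)
    moreover have "C (n0 + 2 * k) \<le> C (Suc (n0 + 2 * k))" "C (Suc (n0 + 2 * k)) \<le> C (n0 + 2 * k) + 1"
      using CS[of "n0 + 2 * k"] by auto
    ultimately show ?thesis
      using *[of k] c by linarith
  qed
  have "(\<lambda>N. freq P N - c / 2) \<longlonglongrightarrow> 0"
  proof (rule Lim_null_comparison)
    show "(\<lambda>N. (2 + \<bar>C n0\<bar> + \<bar>c / 2 * real n0\<bar>) / real N) \<longlonglongrightarrow> 0"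
      by (rule lim_const_over_n)
    show "\<forall>\<^sub>F N in sequentially. norm (freq P N - c / 2) \<le> (2 + \<bar>C n0\<bar> + \<bar>c / 2 * real n0\<bar>) / real N"
      using eventually_ge_at_top[of n0] eventually_gt_at_top[of 0]
    proof eventually_elim
      case (elim N)
      have "freq P N - c / 2 = (C N - c / 2 * real N) / real N"
        using elim by (simp add: freq_def C_def field_simps)
      moreover have "\<bar>C N - c / 2 * real N\<bar> \<le> 2 + \<bar>C n0\<bar> + \<bar>c / 2 * real n0\<bar>"
        using bound[OF elim(1)] unfolding right_diff_distrib by linarith
      ultimately show ?case
        using elim by (simp add: abs_divide divide_right_mono)
    qed
  qed
  then show ?thesis
    by (auto simp: convergent_def LIM_zero_iff)
qed

section \<open>Overriding a sequence on sparse windows\<close>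

lemma less_power4: "k < (4::nat) ^ k"
  by (induction k) auto

lemma finite_power4_less: "finite {k. (4::nat) ^ k < N}"
  by (rule finite_subset[of _ "{..<N}"]) (auto intro: less_trans[OF less_power4])

lemma sum_power4_less_le: "(\<Sum>k | 4 ^ k < N. 4 ^ k) \<le> 2 * (N::nat)"
proof (cases "{k. 4 ^ k < N} = {}")
  case False
  note fin = finite_power4_less[of N]
  define K where "K = Max {k. 4 ^ k < N}"
  have K: "4 ^ K < N"
    using Max_in[OF fin False] by (simp add: K_def)
  have "(\<Sum>k\<le>m. 4 ^ k) \<le> 2 * (4 ^ m :: nat)" for m
    by (induction m) auto
  moreover have "(\<Sum>k | 4 ^ k < N. 4 ^ k) \<le> (\<Sum>k\<le>K. 4 ^ k :: nat)"
    by (rule sum_mono2) (auto simp: K_def intro: Max_ge[OF fin])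
  ultimately have "(\<Sum>k | 4 ^ k < N. 4 ^ k) \<le> (2 * 4 ^ K :: nat)"
    using le_trans[OF _ \<open>\<And>m. (\<Sum>k\<le>m. 4 ^ k) \<le> 2 * (4 ^ m :: nat)\<close>[of K]] by simp
  with K show ?thesis by simp
qed simp

lemma freq_null_windows:
  assumes "filterlim z at_top sequentially"
  shows "freq (\<lambda>n. \<exists>k. 4 ^ k \<le> n \<and> (n - 4 ^ k) * Suc (z k) < 4 ^ k) \<longlonglongrightarrow> 0"
proof (rule freq_nullI)
  fix e :: real assume e: "e > 0"
  \<comment> \<open>A late window has at most \<open>4 ^ k / Suc M\<close> points up to rounding,
    and rounding at most doubles this bound; \<open>4 / e\<close> brings the result below
    \<open>e / 2 * 4 ^ k\<close>. The remaining factor 2 is lost in the sum of the powers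
    \<open>4 ^ k < N\<close>.\<close>
  obtain M where M: "4 / e < real (Suc M)"
    using reals_Archimedean2[of "4 / e"] by (metis less_Suc_eq of_nat_less_iff order_less_trans)
  obtain K0 where K0: "\<And>k. k \<ge> K0 \<Longrightarrow> M \<le> z k"
    using assms unfolding filterlim_at_top eventually_sequentially by blast
  \<comment> \<open>\<open>Suc M \<le> K\<close> yields \<open>Suc M \<le> 4 ^ k\<close> for
    \<open>k \<ge> K\<close>, so the rounding term 1 is at most
    \<open>4 ^ k / Suc M\<close>.\<close>
  define K where "K = max K0 (Suc M)"
  define W where "W k = {n. 4 ^ k \<le> n \<and> (n - 4 ^ k) * Suc M < 4 ^ k}" for k
  define A where "A N = {n. n < N \<and> (\<exists>k. 4 ^ k \<le> n \<and> (n - 4 ^ k) * Suc (z k) < 4 ^ k)}" for N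
  have W: "W k \<subseteq> (\<lambda>d. d + 4 ^ k) ` {..4 ^ k div Suc M}" for k
  proof
    fix n assume n: "n \<in> W k"
    then have "n - 4 ^ k \<le> 4 ^ k div Suc M"
      by (auto simp: W_def less_eq_div_iff_mult_less_eq simp del: mult_Suc_right)
    then show "n \<in> (\<lambda>d. d + 4 ^ k) ` {..4 ^ k div Suc M}"
      using n by (intro image_eqI[of _ _ "n - 4 ^ k"]) (auto simp: W_def)
  qed
  have finW: "finite (W k)" for k
    using W by (rule finite_subset) simp
  have cardW: "real (card (W k)) \<le> e / 2 * 4 ^ k" if "k \<ge> K" for k
  proof -
    have "Suc M \<le> k"
      using that by (simp add: K_def)
    also have "k < 4 ^ k"
      by (rule less_power4)
    finally have ge: "real (Suc M) \<le> 4 ^ k"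
      by (metis less_imp_le of_nat_le_iff of_nat_numeral of_nat_power)
    have "card (W k) \<le> card ((\<lambda>d. d + 4 ^ k) ` {..4 ^ k div Suc M})"
      by (rule card_mono[OF _ W]) simp
    also have "\<dots> \<le> Suc (4 ^ k div Suc M)"
      using card_image_le[of "{..4 ^ k div Suc M}" "\<lambda>d. d + 4 ^ k"] by simp
    finally have "real (card (W k)) \<le> 1 + real (4 ^ k div Suc M)"
      by linarith
    also have "real (4 ^ k div Suc M) \<le> 4 ^ k / real (Suc M)"
      using of_nat_div_le_of_nat[of "4 ^ k" "Suc M", where ?'a = real] by simp
    also have "1 + 4 ^ k / real (Suc M) \<le> 2 * (4 ^ k / real (Suc M))"
    proof -
      have "1 \<le> 4 ^ k / real (Suc M)"
        using ge by (subst le_divide_eq) simp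
      then show ?thesis by linarith
    qed
    also have "\<dots> \<le> e / 2 * 4 ^ k"
    proof -
      have "2 / real (Suc M) \<le> e / 2"
        using M e by (simp add: field_simps)
      from mult_right_mono[OF this, of "4 ^ k"] show ?thesis
        by simp
    qed
    finally show ?thesis by simp
  qed
  have "real (card (A N)) \<le> 2 * 4 ^ K + e * real N" for N
  proof -
    define S where "S = {k. K \<le> k \<and> 4 ^ k < N}"
    note finS = finite_power4_less[of N]
    have "A N \<subseteq> {..<2 * 4 ^ K} \<union> (\<Union>k\<in>S. W k)"
    proof
      fix n assume "n \<in> A N"
      then obtain k where n: "n < N" and k: "4 ^ k \<le> n" "(n - 4 ^ k) * Suc (z k) < 4 ^ k"
        by (auto simp: A_def)
      show "n \<in> {..<2 * 4 ^ K} \<union> (\<Union>k\<in>S. W k)"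
      proof (cases "K \<le> k")
        case True
        then have "M \<le> z k"
          using K0 by (simp add: K_def)
        then have "(n - 4 ^ k) * Suc M \<le> (n - 4 ^ k) * Suc (z k)"
          by simp
        then have "n \<in> W k"
          using k unfolding W_def by (blast intro: order_le_less_trans)
        then show ?thesis
          using True n k by (auto simp: S_def intro!: bexI[of _ k])
      next
        case False
        have "n - 4 ^ k \<le> (n - 4 ^ k) * Suc (z k)"
          by simp
        then have "n < 2 * 4 ^ k"
          using k by linarith
        also have "2 * 4 ^ k \<le> (2 * 4 ^ K :: nat)"
          using False by (simp add: power_increasing)
        finally show ?thesis by simp
      qed
    qed
    then have "card (A N) \<le> card ({..<2 * 4 ^ K} \<union> (\<Union>k\<in>S. W k))"
      using finS finW by (intro card_mono) (auto simp: S_def)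
    also have "\<dots> \<le> 2 * 4 ^ K + card (\<Union>k\<in>S. W k)"
      using card_Un_le[of "{..<2 * 4 ^ K}" "\<Union>k\<in>S. W k"] by simp
    also have "card (\<Union>k\<in>S. W k) \<le> (\<Sum>k\<in>S. card (W k))"
      using finS by (intro card_UN_le) (auto simp: S_def)
    finally have "real (card (A N)) \<le> real (2 * 4 ^ K + (\<Sum>k\<in>S. card (W k)))"
      by (simp only: of_nat_le_iff add_left_mono)
    then have "real (card (A N)) \<le> 2 * 4 ^ K + (\<Sum>k\<in>S. real (card (W k)))"
      by simp
    also have "(\<Sum>k\<in>S. real (card (W k))) \<le> (\<Sum>k\<in>S. e / 2 * 4 ^ k)"
      by (rule sum_mono, rule cardW) (simp add: S_def)
    also have "\<dots> \<le> (\<Sum>k | 4 ^ k < N. e / 2 * 4 ^ k)"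
      using finS e by (intro sum_mono2) (auto simp: S_def)
    also have "\<dots> = e / 2 * real (\<Sum>k | 4 ^ k < N. 4 ^ k)"
      by (simp add: sum_distrib_left)
    also have "\<dots> \<le> e / 2 * real (2 * N)"
      using e sum_power4_less_le[of N] by (intro mult_left_mono) (simp_all only: of_nat_le_iff)
    finally show ?thesis by simp
  qed
  then show "\<exists>C. \<forall>N. real (card {n. n < N \<and> (\<exists>k. 4 ^ k \<le> n \<and> (n - 4 ^ k) * Suc (z k) < 4 ^ k)})
      \<le> C + e * real N"
    unfolding A_def by blast
qed

text \<open>
  The positions \<open>4 ^ k, \<dots>, 4 ^ k + 2\<close> are spared so that they can carry a marker that survives
  every choice of \<open>z\<close>.
\<close>

definition override :: "'a \<Rightarrow> (nat \<Rightarrow> 'a) \<Rightarrow> (nat \<Rightarrow> nat) \<Rightarrow> nat \<Rightarrow> 'a" where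
  "override a G z n =
     (if \<exists>k. 4 ^ k + 3 \<le> n \<and> (n - 4 ^ k) * Suc (z k) < 4 ^ k then a else G n)"

text \<open>Since \<open>k < 4 ^ k\<close>, only entries \<open>z k\<close> with
  \<open>k < m\<close> can decide about position \<open>m\<close>. This is the source of continuity
  of the reduction.\<close>

lemma override_cong_prefix:
  assumes "\<forall>i<n. z' i = z i" "m < n"
  shows "override a G z' m = override a G z m"
proof -
  have "k < n" if "4 ^ k + 3 \<le> m" for k :: nat
    using that assms(2) less_power4[of k] by linarith
  then show ?thesis
    unfolding override_def using assms(1) by (metis (no_types, lifting))
qed

lemma power4_Suc_mono: "k' < k \<Longrightarrow> 4 * 4 ^ k' \<le> (4 ^ k :: nat)"
  using power_increasing[of "Suc k'" k "4::nat"] by simp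

text \<open>Window \<open>k\<close> starts only at offset 3, and an earlier window \<open>k'\<close>
  ends before \<open>2 * 4 ^ k'\<close>, hence before \<open>4 ^ k\<close>.\<close>

lemma override_marker:
  assumes "i \<le> 2"
  shows "override a G z (4 ^ k + i) = G (4 ^ k + i)"
proof -
  have False if k': "4 ^ k' + 3 \<le> 4 ^ k + i" "(4 ^ k + i - 4 ^ k') * Suc (z k') < 4 ^ k'" for k'
  proof -
    have "k' < k"
      using k'(1) assms power4_Suc_mono[of k k'] by (cases k' k rule: linorder_cases) auto
    have "4 ^ k + i - 4 ^ k' \<le> (4 ^ k + i - 4 ^ k') * Suc (z k')"
      by simp
    then have "4 ^ k + i - 4 ^ k' < 4 ^ k'"
      using k'(2) by linarith
    then show False
      using power4_Suc_mono[OF \<open>k' < k\<close>] by linarith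
  qed
  then show ?thesis
    unfolding override_def by metis
qed

text \<open>Window \<open>k\<close> ends before \<open>2 * 4 ^ k\<close>, whatever
  \<open>z k\<close> is. These gaps reveal the frequency of the original sequence.\<close>

lemma override_gap:
  assumes "2 * 4 ^ k \<le> n" "n < 4 * 4 ^ k"
  shows "override a G z n = G n"
proof -
  have False if k': "4 ^ k' + 3 \<le> n" "(n - 4 ^ k') * Suc (z k') < 4 ^ k'" for k'
  proof -
    have "n - 4 ^ k' \<le> (n - 4 ^ k') * Suc (z k')"
      by simp
    then have "n - 4 ^ k' < 4 ^ k'"
      using k'(2) by linarith
    then show False
      using power4_Suc_mono[of k' k] power4_Suc_mono[of k k'] k'(1) assms
      by (cases k' k rule: linorder_cases) auto
  qed
  then show ?thesis
    unfolding override_def by metis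
qed

lemma freq_occurs_override:
  assumes "filterlim z at_top sequentially" "freq (occurs w G) \<longlonglongrightarrow> \<theta>"
  shows "freq (occurs w (override a G z)) \<longlonglongrightarrow> \<theta>"
  by (rule freq_occurs_cong_null[OF assms(2)], rule freq_null_mono[OF freq_null_windows[OF assms(1)]])
     (auto simp: override_def split: if_splits intro: add_leD1)

text \<open>A limit would be visible twice: on the untouched gaps it would be
  \<open>\<theta>\<close>, and on windows with bounded \<open>z k\<close>, which are filled with
  \<open>a\<close> up to three positions, it would be 1.\<close>

lemma freq_override_not_convergent:
  assumes z: "\<not> filterlim z at_top sequentially" and G: "freq (\<lambda>n. G n = a) \<longlonglongrightarrow> \<theta>" and "\<theta> \<noteq> 1"
  shows "\<not> convergent (freq (\<lambda>n. override a G z n = a))"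
proof
  assume "convergent (freq (\<lambda>n. override a G z n = a))"
  then obtain \<eta> where y: "freq (\<lambda>n. override a G z n = a) \<longlonglongrightarrow> \<eta>"
    by (auto simp: convergent_def)
  have lim4: "filterlim (\<lambda>k. 2 * 4 ^ k :: nat) at_top sequentially"
  proof (rule filterlim_at_top_mono[OF filterlim_ident])
    show "\<forall>\<^sub>F k in sequentially. k \<le> (2 * 4 ^ k :: nat)"
    proof (intro always_eventually allI)
      show "k \<le> 2 * 4 ^ k" for k :: nat
        using less_power4[of k] by linarith
    qed
  qed
  have "(\<lambda>k. real (card {n. 2 * 4 ^ k \<le> n \<and> n < 4 * 4 ^ k \<and> override a G z n = a}) /
      real (4 * 4 ^ k - 2 * 4 ^ k)) \<longlonglongrightarrow> \<eta>"
    by (rule freq_window[OF y lim4, of _ 2]) auto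
  moreover have "(\<lambda>k. real (card {n. 2 * 4 ^ k \<le> n \<and> n < 4 * 4 ^ k \<and> G n = a}) /
      real (4 * 4 ^ k - 2 * 4 ^ k)) \<longlonglongrightarrow> \<theta>"
    by (rule freq_window[OF G lim4, of _ 2]) auto
  moreover have "{n. 2 * 4 ^ k \<le> n \<and> n < 4 * 4 ^ k \<and> override a G z n = a} =
      {n. 2 * 4 ^ k \<le> n \<and> n < 4 * 4 ^ k \<and> G n = a}" for k
    using override_gap[of k _ a G z] by auto
  ultimately have "\<eta> = \<theta>"
    using LIMSEQ_unique by simp
  obtain Z where Z: "\<exists>\<^sub>F k in sequentially. z k < Z"
    using z unfolding filterlim_at_top frequently_def by (auto simp: not_less)
  \<comment> \<open>\<open>Z \<le> k\<close> makes the later \<open>\<kappa> i - Z\<close> a genuine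
    subtraction. As \<open>Suc (z k) \<le> Z \<le> 4 ^ Z\<close>, the overwritten part of window
    \<open>\<kappa> i\<close> reaches up to \<open>4 ^ \<kappa> i + 4 ^ (\<kappa> i - Z)\<close>,
    and this stretch is a fixed fraction of its right end.\<close>
  have "\<exists>\<^sub>F k in sequentially. z k < Z \<and> Z \<le> k"
    using Z eventually_ge_at_top[of Z] by (rule frequently_eventually_frequently)
  then have "infinite {k. z k < Z \<and> Z \<le> k}"
    by (simp add: frequently_cofinite flip: cofinite_eq_sequentially)
  then obtain \<kappa> :: "nat \<Rightarrow> nat"
    where \<kappa>: "strict_mono \<kappa>" "\<And>i. z (\<kappa> i) < Z \<and> Z \<le> \<kappa> i"
    using infinite_enumerate[of "{k. z k < Z \<and> Z \<le> k}"] by auto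
  define j where "j i = \<kappa> i - Z" for i
  have \<kappa>j: "\<kappa> i = Z + j i" for i
    using \<kappa>(2)[of i] unfolding j_def by linarith
  have j: "i \<le> j i" for i
  proof (rule strict_mono_imp_increasing)
    show "strict_mono j"
      using \<kappa>(1) by (simp add: strict_mono_def \<kappa>j)
  qed
  let ?f = "\<lambda>i. 4 ^ \<kappa> i :: nat" and ?g = "\<lambda>i. 4 ^ \<kappa> i + 4 ^ j i :: nat"
  let ?C = "\<lambda>i. {n. ?f i \<le> n \<and> n < ?g i \<and> override a G z n = a}"
  have "(\<lambda>i. real (card (?C i)) / real (?g i - ?f i)) \<longlonglongrightarrow> \<eta>"
  proof (rule freq_window[OF y, of _ _ "2 * 4 ^ Z"])
    show "filterlim ?f at_top sequentially"
    proof (rule filterlim_at_top_mono[OF filterlim_ident], intro always_eventually allI)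
      show "i \<le> (4 ^ \<kappa> i :: nat)" for i
        using strict_mono_imp_increasing[OF \<kappa>(1), of i] less_power4[of "\<kappa> i"] by linarith
    qed
    show "?f i < ?g i" for i by simp
    show "?g i \<le> 2 * 4 ^ Z * (?g i - ?f i)" for i
      by (simp add: \<kappa>j power_add)
  qed
  moreover have "(\<lambda>i. real (card (?C i)) / real (?g i - ?f i)) \<longlonglongrightarrow> 1"
  proof (rule tendsto_sandwich)
    \<comment> \<open>The 3 counts the spared marker positions at the start of the window.\<close>
    have "3 / 4 ^ j i \<le> 3 / real (Suc i)" for i
    proof -
      have "Suc i \<le> 4 ^ i"
        using less_power4[of i] by simp
      also have "\<dots> \<le> 4 ^ j i"
        using j by (simp add: power_increasing)
      finally have "real (Suc i) \<le> 4 ^ j i"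
        by (metis of_nat_le_iff of_nat_numeral of_nat_power)
      then show ?thesis
        by (intro divide_left_mono) auto
    qed
    then have *: "(\<lambda>i. 3 / 4 ^ j i) \<longlonglongrightarrow> (0::real)"
      by (intro tendsto_sandwich[OF _ _ tendsto_const LIMSEQ_Suc[OF lim_const_over_n[of 3]]])
         (auto intro: always_eventually)
    show "(\<lambda>i. 1 - 3 / 4 ^ j i) \<longlonglongrightarrow> (1::real)"
      using tendsto_diff[OF tendsto_const *, of 1] by simp
    show "\<forall>\<^sub>F i in sequentially. 1 - 3 / 4 ^ j i \<le> real (card (?C i)) / real (?g i - ?f i)"
    proof (rule always_eventually, rule allI)
      fix i
      have "n \<in> ?C i" if n: "n \<in> {?f i + 3..<?g i}" for n
      proof -
        have "(n - 4 ^ \<kappa> i) * Suc (z (\<kappa> i)) < 4 ^ j i * 4 ^ Z"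
        proof (rule mult_less_le_imp_less)
          have "Suc (z (\<kappa> i)) \<le> Z"
            using \<kappa>(2) by (simp add: Suc_le_eq)
          also have "Z \<le> 4 ^ Z"
            using less_power4[of Z] by simp
          finally show "Suc (z (\<kappa> i)) \<le> 4 ^ Z" .
        qed (use n in auto)
        then have "(n - 4 ^ \<kappa> i) * Suc (z (\<kappa> i)) < 4 ^ \<kappa> i"
          unfolding \<kappa>j power_add by (simp only: mult.commute)
        then have "override a G z n = a"
          using n unfolding override_def by auto
        then show ?thesis
          using n by auto
      qed
      then have "card {?f i + 3..<?g i} \<le> card (?C i)"
        by (intro card_mono) auto
      then have "4 ^ j i \<le> card (?C i) + 3"
        by simp
      then have "real (4 ^ j i) \<le> real (card (?C i) + 3)"
        by (simp only: of_nat_le_iff)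
      then have "(4 ^ j i - 3) / 4 ^ j i \<le> real (card (?C i)) / 4 ^ j i"
        by (intro divide_right_mono) auto
      then show "1 - 3 / 4 ^ j i \<le> real (card (?C i)) / real (?g i - ?f i)"
        by (simp add: diff_divide_distrib)
    qed
    show "\<forall>\<^sub>F i in sequentially. real (card (?C i)) / real (?g i - ?f i) \<le> 1"
    proof (rule always_eventually, rule allI)
      fix i
      have "card (?C i) \<le> card {?f i..<?g i}"
        by (rule card_mono) auto
      then have "real (card (?C i)) \<le> real (4 ^ j i)"
        by (simp only: of_nat_le_iff) simp
      then show "real (card (?C i)) / real (?g i - ?f i) \<le> 1"
        by simp
    qed
  qed simp
  ultimately have "\<eta> = 1"
    using LIMSEQ_unique by blast
  with \<open>\<eta> = \<theta>\<close> \<open>\<theta> \<noteq> 1\<close> show False by simp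
qed

text \<open>The distance 2 matches the hypothesis of \<open>point_inner\<close>: a sequence with
  infinitely many \<open>s n \<noteq> s (n + 2)\<close> has no tail coding 0 or 1.\<close>

definition marked :: "'a \<Rightarrow> 'a \<Rightarrow> (nat \<Rightarrow> 'a) \<Rightarrow> nat \<Rightarrow> 'a" where
  "marked a b G n =
     (if \<exists>k. n = 4 ^ Suc k then a else if \<exists>k. n = 4 ^ Suc k + 2 then b else G n)"

lemma marked_neq:
  assumes "a \<noteq> b"
  shows "marked a b G (4 ^ Suc k) \<noteq> marked a b G (4 ^ Suc k + 2)"
proof -
  \<comment> \<open>Otherwise the first branch of \<open>marked\<close> would overrule the second
    marker. With exponents from 1 on, the two kinds of positions are 2 and 0 modulo 4.\<close>
  have False if "4 ^ Suc k + 2 = (4 ^ Suc k' :: nat)" for k'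
  proof -
    have "4 dvd (4 ^ Suc k + 2 :: nat)" "4 dvd (4 ^ Suc k :: nat)"
      unfolding that by simp_all
    then have "4 dvd (2 :: nat)"
      using dvd_add_right_iff by blast
    then show False
      by simp
  qed
  then show ?thesis
    using assms by (auto simp: marked_def simp del: power_Suc)
qed

lemma freq_occurs_marked:
  assumes "freq (occurs w G) \<longlonglongrightarrow> \<theta>"
  shows "freq (occurs w (marked a b G)) \<longlonglongrightarrow> \<theta>"
proof (rule freq_occurs_cong_null[OF assms])
  \<comment> \<open>The markers lie in the windows of the parameter \<open>k - 1\<close>: from
    exponent 1 on, offset 2 only requires \<open>2 * k < 4 ^ k\<close>. So they have density 0 by
    the window estimate.\<close>
  have "filterlim (\<lambda>k::nat. k - 1) at_top sequentially"
    by (rule filterlim_minus_const_nat_at_top)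
  then have null: "freq (\<lambda>n. \<exists>k. 4 ^ k \<le> n \<and> (n - 4 ^ k) * Suc (k - 1) < 4 ^ k) \<longlonglongrightarrow> 0"
    by (rule freq_null_windows)
  show "freq (\<lambda>n. G n \<noteq> marked a b G n) \<longlonglongrightarrow> 0"
  proof (rule freq_null_mono[OF null])
    fix n assume "G n \<noteq> marked a b G n"
    then consider k where "n = 4 ^ Suc k" | k where "n = 4 ^ Suc k + 2"
      by (auto simp: marked_def split: if_splits simp del: power_Suc)
    then show "\<exists>k. 4 ^ k \<le> n \<and> (n - 4 ^ k) * Suc (k - 1) < 4 ^ k"
    proof cases
      case (1 k)
      then show ?thesis by (auto intro!: exI[of _ "Suc k"])
    next
      case (2 k)
      have "2 * Suc k < (4 ^ Suc k :: nat)"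
        by (induction k) auto
      then show ?thesis
        using 2 by (auto intro!: exI[of _ "Suc k"])
    qed
  qed
qed

text \<open>\<open>floor_sqrt n\<close> is the index of the block between consecutive squares that
  contains \<open>n\<close>. The bad positions are the last \<open>d\<close> of each block, and only
  about \<open>sqrt N\<close> blocks start below \<open>N\<close>.\<close>

lemma freq_null_floor_sqrt:
  "freq (\<lambda>n. floor_sqrt (n + d) \<noteq> floor_sqrt n) \<longlonglongrightarrow> 0"
proof (rule freq_nullI)
  fix e :: real assume e: "e > 0"
  define B where "B i = {Suc i ^ 2 - d..<Suc i ^ 2}" for i :: nat
  have "real (card {n. n < N \<and> floor_sqrt (n + d) \<noteq> floor_sqrt n}) \<le>
      real d * (real d / e + 1) + e * real N" for N
  proof (cases "d = 0")
    case False
    define r where "r = e / real d"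
    have r: "r > 0"
      using e False by (simp add: r_def)
    have "{n. n < N \<and> floor_sqrt (n + d) \<noteq> floor_sqrt n} \<subseteq> (\<Union>i\<in>{i. i ^ 2 < N}. B i)"
    proof
      fix n assume "n \<in> {n. n < N \<and> floor_sqrt (n + d) \<noteq> floor_sqrt n}"
      then have n: "n < N" "floor_sqrt n < floor_sqrt (n + d)"
        using mono_floor_sqrt'[of n "n + d"] by auto
      have "(floor_sqrt n)\<^sup>2 < N"
        using n(1) floor_sqrt_power2_le[of n] by linarith
      moreover have "Suc (floor_sqrt n) ^ 2 \<le> n + d"
        using n(2) by (simp add: Suc_le_eq flip: le_floor_sqrt_iff)
      ultimately show "n \<in> (\<Union>i\<in>{i. i ^ 2 < N}. B i)"
        using Suc_floor_sqrt_power2_gt[of n] by (auto simp: B_def intro!: exI[of _ "floor_sqrt n"])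
    qed
    \<comment> \<open>A linear bound of small slope replaces the square root: either
      \<open>i < 1 / r\<close>, or \<open>i \<le> r * i ^ 2 < r * N\<close>.\<close>
    moreover have sub: "{i. i ^ 2 < N} \<subseteq> {..<nat \<lceil>1 / r + r * real N\<rceil>}"
    proof
      fix i assume "i \<in> {i. i ^ 2 < N}"
      then have i: "real i * real i < real N"
        by (metis mem_Collect_eq of_nat_less_iff of_nat_mult power2_eq_square)
      have "real i < 1 / r + r * real N"
      proof (cases "real i < 1 / r")
        case True
        then show ?thesis
          using r by (intro add_strict_increasing2[of "r * real N", simplified add.commute]) auto
      next
        case False
        then have "1 \<le> r * real i"
          using r by (simp add: field_simps)
        then have "real i \<le> r * real i * real i"
          using mult_right_mono[of 1 "r * real i" "real i"] by simp
        also have "\<dots> < r * real N"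
          using i r by simp
        also have "\<dots> < 1 / r + r * real N"
          using r by simp
        finally show ?thesis .
      qed
      then show "i \<in> {..<nat \<lceil>1 / r + r * real N\<rceil>}"
        by (simp add: zless_nat_eq_int_zless less_ceiling_iff)
    qed
    ultimately have "card {n. n < N \<and> floor_sqrt (n + d) \<noteq> floor_sqrt n} \<le>
        card (\<Union>i\<in>{i. i ^ 2 < N}. B i)"
      by (intro card_mono finite_UN_I) (auto simp: B_def intro: finite_subset[OF sub])
    also have "\<dots> \<le> (\<Sum>i | i ^ 2 < N. card (B i))"
      by (intro card_UN_le finite_subset[OF sub]) simp
    also have "\<dots> \<le> (\<Sum>i | i ^ 2 < N. d)"
      by (rule sum_mono) (simp add: B_def)
    also have "\<dots> = card {i. i ^ 2 < N} * d"
      by simp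
    also have "\<dots> \<le> nat \<lceil>1 / r + r * real N\<rceil> * d"
      using card_mono[OF _ sub] by (intro mult_right_mono) auto
    finally have "real (card {n. n < N \<and> floor_sqrt (n + d) \<noteq> floor_sqrt n}) \<le>
        real (nat \<lceil>1 / r + r * real N\<rceil>) * real d"
      by (simp flip: of_nat_mult)
    also have "\<dots> \<le> (1 / r + r * real N + 1) * real d"
      using r by (intro mult_right_mono) (auto simp: of_nat_nat)
    also have "\<dots> = real d * (real d / e + 1) + e * real N"
      using e False by (simp add: r_def field_simps)
    finally show ?thesis .
  qed (use e in simp)
  then show "\<exists>C. \<forall>N. real (card {n. n < N \<and> floor_sqrt (n + d) \<noteq> floor_sqrt n}) \<le> C + e * real N"
    by blast
qed

section \<open>Itineraries\<close>

text \<open>With a single digit the map is, apart from the point 1, the identity or the reflection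
  of the unit interval; every orbit is then eventually periodic and no point is irregular. Two
  digits give a uniform contraction ratio and two symbols to write with.\<close>

locale gls_system =
  fixes D :: "nat set" and l r :: "nat \<Rightarrow> real" and \<epsilon> :: "nat \<Rightarrow> nat"
  assumes family: "gls_family D l r" and two_digits: "\<exists>m\<in>D. \<exists>n\<in>D. m \<noteq> n"
begin

abbreviation "T \<equiv> gls_map D l r \<epsilon>"

abbreviation "cyl \<equiv> gls_cylinder D l r \<epsilon>"

definition len :: "nat \<Rightarrow> real" where
  "len a = r a - l a"

lemma bounds:
  assumes "a \<in> D"
  shows "0 \<le> l a" "l a < r a" "r a \<le> 1" "0 < len a"
proof -
  have "{l a..<r a} \<noteq> {}" "{l a..<r a} \<subseteq> {0..1}"
    using family assms by (auto simp: gls_family_def)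
  then show "0 \<le> l a" "l a < r a" "r a \<le> 1"
    using atLeastLessThan_subseteq_atLeastAtMost_iff[of "l a" "r a" 0 1] by auto
  then show "0 < len a"
    by (simp add: len_def)
qed

lemma digit_unique:
  assumes "a \<in> D" "b \<in> D" "x \<in> {l a..<r a}" "x \<in> {l b..<r b}"
  shows "a = b"
proof (rule ccontr)
  assume "a \<noteq> b"
  then have "{l a..<r a} \<inter> {l b..<r b} = {}"
    using family assms(1,2) unfolding gls_family_def disjoint_family_on_def by blast
  then show False
    using assms(3,4) by blast
qed

lemma sum_len_le:
  assumes "finite F" "F \<subseteq> D"
  shows "(\<Sum>a\<in>F. len a) \<le> 1"
proof -
  have "(len has_sum 1) D"
    using family by (simp add: gls_family_def len_def[abs_def])
  then show ?thesis
    using has_sum_mono2[OF has_sum_finite[OF assms(1), of len] _ assms(2)] bounds(4)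
    by (meson Diff_iff less_imp_le)
qed

text \<open>Every digit differs from one of two fixed digits, and has to leave room for its length
  in the total length 1.\<close>

lemma contraction_ratio:
  obtains \<rho> where "0 \<le> \<rho>" "\<rho> < 1" "\<And>a. a \<in> D \<Longrightarrow> len a \<le> \<rho>"
proof -
  obtain m n where mn: "m \<in> D" "n \<in> D" "m \<noteq> n"
    using two_digits by blast
  have le: "len a + len b \<le> 1" if "a \<in> D" "b \<in> D" "a \<noteq> b" for a b
    using sum_len_le[of "{a, b}"] that by simp
  define \<rho> where "\<rho> = max (1 - len m) (1 - len n)"
  have "len a \<le> \<rho>" if "a \<in> D" for a
    using le[OF that mn(1)] le[OF that mn(2)] mn by (cases "a = m") (auto simp: \<rho>_def)
  moreover have "\<rho> < 1" "0 \<le> \<rho>"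
    using bounds(4)[OF mn(1)] bounds(4)[OF mn(2)] le[OF mn] by (auto simp: \<rho>_def)
  ultimately show ?thesis
    using that by blast
qed

lemma T_on_digit:
  assumes "a \<in> D" "x \<in> {l a..<r a}"
  shows "T x = (if \<epsilon> a = 0 then (x - l a) / len a else (r a - x) / len a)"
proof -
  have "(THE n. n \<in> D \<and> x \<in> {l n..<r n}) = a"
    using assms digit_unique by (intro the_equality) blast+
  then show ?thesis
    unfolding gls_map_def Let_def len_def using assms by auto
qed

lemma T_off_digits:
  assumes "\<And>a. a \<in> D \<Longrightarrow> x \<notin> {l a..<r a}"
  shows "T x = 0"
  unfolding gls_map_def using assms by auto

lemma T_in_unit: "T x \<in> {0..1}"
proof (cases "\<exists>a\<in>D. x \<in> {l a..<r a}")
  case True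
  then obtain a where a: "a \<in> D" "x \<in> {l a..<r a}" by blast
  then show ?thesis
    using bounds[OF a(1)] by (auto simp: T_on_digit[OF a] len_def divide_simps)
next
  case False
  then show ?thesis
    using T_off_digits[of x] by auto
qed

lemma T_pow_in_unit: "x \<in> {0..1} \<Longrightarrow> (T ^^ n) x \<in> {0..1}"
  by (cases n) (simp_all only: funpow.simps comp_apply T_in_unit id_apply)

lemma T_1: "T 1 = 0"
  by (rule T_off_digits) (use bounds(3) in force)

lemma T_0: "T 0 \<in> {0, 1}"
proof (cases "\<exists>a\<in>D. 0 \<in> {l a..<r a}")
  case True
  then obtain a where a: "a \<in> D" "0 \<in> {l a..<r a}" by blast
  then have "l a = 0"
    using bounds(1)[OF a(1)] by simp
  then show ?thesis
    using a bounds(2)[OF a(1)] by (simp add: T_on_digit[OF a] len_def)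
next
  case False
  then show ?thesis
    using T_off_digits[of 0] by auto
qed

lemma T_01: "x \<in> {0, 1} \<Longrightarrow> T x \<in> {0, 1} \<and> T (T (T x)) = T x"
  using T_0 T_1 by auto

text \<open>The inverse of \<open>T\<close> on the \<open>a\<close>-th interval, extended to the
  closed unit interval. At \<open>y = 0\<close> or \<open>y = 1\<close> the value may leave the
  half-open interval, so \<open>T_branch\<close> is confined to inner \<open>y\<close>.\<close>

definition branch :: "nat \<Rightarrow> real \<Rightarrow> real" where
  "branch a y = (if \<epsilon> a = 0 then l a + len a * y else r a - len a * y)"

lemma branch_diff: "a \<in> D \<Longrightarrow> \<bar>branch a y - branch a y'\<bar> = len a * \<bar>y - y'\<bar>"
  using bounds(4)[of a] by (auto simp: branch_def abs_mult simp flip: right_diff_distrib)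

lemma branch_mem:
  assumes "a \<in> D" "y \<in> {0..1}"
  shows "branch a y \<in> {l a..r a}"
proof -
  have "0 \<le> len a * y" "len a * y \<le> len a"
    using bounds(4)[OF assms(1)] assms(2) by (auto simp: mult_left_le)
  then show ?thesis
    by (auto simp: branch_def len_def)
qed

lemma branch_mem_unit: "a \<in> D \<Longrightarrow> y \<in> {0..1} \<Longrightarrow> branch a y \<in> {0..1}"
  using branch_mem[of a y] bounds[of a] by auto

lemma branch_mem_inner:
  assumes "a \<in> D" "y \<in> {0<..<1}"
  shows "branch a y \<in> {l a<..<r a}"
proof -
  have "0 < len a * y" "len a * y < len a"
    using bounds(4)[OF assms(1)] assms(2) by auto
  then show ?thesis
    by (auto simp: branch_def len_def)
qed

lemma T_branch:
  assumes "a \<in> D" "y \<in> {0<..<1}"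
  shows "T (branch a y) = y"
proof -
  have "branch a y \<in> {l a..<r a}"
    using branch_mem_inner[OF assms] by auto
  then show ?thesis
    using T_on_digit[OF assms(1)] bounds(4)[OF assms(1)] by (auto simp: branch_def)
qed

text \<open>A closed digit interval contains 0 only as left end and 1 only as right end, and
  disjoint intervals cannot share such an end. Hence a coded endpoint determines its digit and the
  next coded point, which is again an endpoint.\<close>

lemma branch_endpoint_unique:
  assumes D: "a \<in> D" "b \<in> D" and y: "y \<in> {0..1}" "z \<in> {0..1}"
    and eq: "branch a y = branch b z" "branch a y \<in> {0, 1}"
  shows "a = b \<and> y = z \<and> y \<in> {0, 1}"
proof -
  have ab: "branch a y \<in> {l a..r a}" "branch a y \<in> {l b..r b}"
    using branch_mem[OF D(1) y(1)] branch_mem[OF D(2) y(2)] eq(1) by auto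
  have "a = b"
  proof (cases "branch a y = 0")
    case True
    then show ?thesis
      using ab bounds[OF D(1)] bounds[OF D(2)] by (intro digit_unique[OF D, of 0]) auto
  next
    case False
    \<comment> \<open>Two intervals that end at 1 overlap, because both contain the larger of their
      left ends.\<close>
    then have "r a = 1" "r b = 1"
      using ab bounds[OF D(1)] bounds[OF D(2)] eq(2) by auto
    then show ?thesis
      using bounds[OF D(1)] bounds[OF D(2)] by (intro digit_unique[OF D, of "max (l a) (l b)"]) auto
  qed
  then have "y = z"
    using branch_diff[OF D(1), of y z] eq(1) bounds(4)[OF D(1)] by simp
  moreover have "y \<in> {0, 1}"
  proof (rule ccontr)
    assume "y \<notin> {0, 1}"
    then have "branch a y \<in> {l a<..<r a}"
      using branch_mem_inner[OF D(1)] y(1) by auto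
    then show False
      using eq(2) bounds[OF D(1)] by auto
  qed
  ultimately show ?thesis
    using \<open>a = b\<close> by blast
qed

section \<open>Coding points by digit sequences\<close>

primrec approx :: "nat \<Rightarrow> (nat \<Rightarrow> nat) \<Rightarrow> real" where
  "approx 0 s = 0"
| "approx (Suc k) s = branch (s 0) (approx k (\<lambda>n. s (Suc n)))"

definition point :: "(nat \<Rightarrow> nat) \<Rightarrow> real" where
  "point s = lim (\<lambda>k. approx k s)"

lemma approx_in_unit: "(\<And>n. s n \<in> D) \<Longrightarrow> approx k s \<in> {0..1}"
  by (induction k arbitrary: s) (simp_all only: approx.simps branch_mem_unit, simp)

lemma approx_Cauchy:
  assumes \<rho>: "0 \<le> \<rho>" "\<And>a. a \<in> D \<Longrightarrow> len a \<le> \<rho>" and s: "\<And>n. s n \<in> D"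
  shows "\<bar>approx k s - approx (k + m) s\<bar> \<le> \<rho> ^ k"
  using s
proof (induction k arbitrary: s)
  case 0
  then show ?case
    using approx_in_unit[of s m] by auto
next
  case (Suc k)
  have "len (s 0) * \<bar>approx k (\<lambda>n. s (Suc n)) - approx (k + m) (\<lambda>n. s (Suc n))\<bar> \<le> \<rho> * \<rho> ^ k"
    using Suc \<rho> by (intro mult_mono) auto
  then show ?case
    using Suc.prems by (simp add: branch_diff)
qed

lemma approx_tendsto:
  assumes "\<And>n. s n \<in> D"
  shows "(\<lambda>k. approx k s) \<longlonglongrightarrow> point s"
proof -
  obtain \<rho> where \<rho>: "0 \<le> \<rho>" "\<rho> < 1" "\<And>a. a \<in> D \<Longrightarrow> len a \<le> \<rho>"
    using contraction_ratio by blast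
  have "Cauchy (\<lambda>k. approx k s)"
  proof (rule CauchyI')
    fix e :: real assume "0 < e"
    moreover have "(\<lambda>k. \<rho> ^ k) \<longlonglongrightarrow> 0"
      using \<rho> by (intro LIMSEQ_power_zero) simp
    ultimately have "\<forall>\<^sub>F k in sequentially. \<rho> ^ k < e"
      by (intro order_tendstoD)
    then obtain M where M: "\<And>k. k \<ge> M \<Longrightarrow> \<rho> ^ k < e"
      unfolding eventually_sequentially by blast
    show "\<exists>M. \<forall>m\<ge>M. \<forall>n>m. dist (approx m s) (approx n s) < e"
    proof (intro exI[of _ M] allI impI)
      fix m n assume "M \<le> m" "m < n"
      then show "dist (approx m s) (approx n s) < e"
        using M[of m] approx_Cauchy[OF \<rho>(1,3), where s = s and k = m and m = "n - m"] assms by (fastforce simp: dist_real_def)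
    qed
  qed
  then show ?thesis
    unfolding point_def by (simp add: Cauchy_convergent_iff convergent_LIMSEQ_iff)
qed

lemma point_in_unit: "(\<And>n. s n \<in> D) \<Longrightarrow> point s \<in> {0..1}"
  by (rule closed_sequentially[OF _ _ approx_tendsto]) (auto simp: approx_in_unit[simplified])

lemma point_unfold:
  assumes "\<And>n. s n \<in> D"
  shows "point s = branch (s 0) (point (\<lambda>n. s (Suc n)))"
proof (rule LIMSEQ_unique)
  show "(\<lambda>k. approx (Suc k) s) \<longlonglongrightarrow> point s"
    using approx_tendsto[OF assms] by (rule LIMSEQ_Suc)
  have "(\<lambda>k. approx k (\<lambda>n. s (Suc n))) \<longlonglongrightarrow> point (\<lambda>n. s (Suc n))"
    by (rule approx_tendsto) (rule assms)
  then have "(\<lambda>k. branch (s 0) (approx k (\<lambda>n. s (Suc n)))) \<longlonglongrightarrow> branch (s 0) (point (\<lambda>n. s (Suc n)))"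
    unfolding branch_def by (auto intro!: tendsto_intros)
  then show "(\<lambda>k. approx (Suc k) s) \<longlonglongrightarrow> branch (s 0) (point (\<lambda>n. s (Suc n)))"
    by simp
qed

text \<open>The modulus of continuity of the coding map, used in
  \<open>code_continuous\<close>.\<close>

lemma point_prefix:
  assumes \<rho>: "0 \<le> \<rho>" "\<And>a. a \<in> D \<Longrightarrow> len a \<le> \<rho>"
    and "\<And>n. s n \<in> D" "\<And>n. s' n \<in> D" "\<And>i. i < k \<Longrightarrow> s i = s' i"
  shows "\<bar>point s - point s'\<bar> \<le> \<rho> ^ k"
  using assms(3-5)
proof (induction k arbitrary: s s')
  case 0
  then show ?case
    using point_in_unit[of s] point_in_unit[of s'] by auto
next
  case (Suc k)
  let ?x = "point (\<lambda>n. s (Suc n))" and ?y = "point (\<lambda>n. s' (Suc n))"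
  have "len (s 0) * \<bar>?x - ?y\<bar> \<le> \<rho> * \<rho> ^ k"
    using Suc \<rho> by (intro mult_mono) auto
  moreover have "\<bar>point s - point s'\<bar> = len (s 0) * \<bar>?x - ?y\<bar>"
    using point_unfold[of s] point_unfold[of s'] Suc.prems branch_diff by simp
  ultimately show ?case by simp
qed

text \<open>Once a tail codes an endpoint, \<open>branch_endpoint_unique\<close> makes all later
  tails code endpoints, each determining its digit and its successor. A deterministic process on two
  states becomes periodic with period at most 2, and so do the digits.\<close>

lemma point_inner:
  assumes s: "\<And>n. s n \<in> D" and aper: "\<And>m. \<exists>n\<ge>m. s n \<noteq> s (n + 2)"
  shows "point (\<lambda>i. s (n + i)) \<in> {0<..<1}"
proof (rule ccontr)
  define x where "x n = point (\<lambda>i. s (n + i))" for n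
  assume "\<not> ?thesis"
  then have "x n \<notin> {0<..<1}"
    by (simp add: x_def)
  have x: "x n \<in> {0..1}" for n
    unfolding x_def by (rule point_in_unit) (rule s)
  have n: "x n \<in> {0, 1}"
    using x[of n] \<open>x n \<notin> {0<..<1}\<close> by auto
  have step: "x k = branch (s k) (x (Suc k))" for k
    using point_unfold[of "\<lambda>i. s (k + i)"] s by (simp add: x_def)
  have det: "s i = s j \<and> x (Suc i) = x (Suc j) \<and> x (Suc i) \<in> {0, 1}"
    if "x i = x j" "x i \<in> {0, 1}" for i j
    using branch_endpoint_unique[OF s s x x, of i "Suc i" j "Suc j"] step[of i] step[of j] that
    by metis
  have x01: "x k \<in> {0, 1}" if "k \<ge> n" for k
    using that by (induction k rule: dec_induct) (use n det in blast)+
  have per: "s (Suc k) = s (Suc k + 2)" if "k \<ge> n" for k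
  proof -
    \<comment> \<open>Pigeonhole among three endpoints; determinism carries each coincidence forward
      to \<open>x (k + 1) = x (k + 3)\<close>.\<close>
    have "x k = x (k + 1) \<or> x k = x (k + 2) \<or> x (k + 1) = x (k + 2)"
      using x01[of k] x01[of "k + 1"] x01[of "k + 2"] that by auto
    then have "x (k + 1) = x (k + 3)"
      using det[of k "k + 1"] det[of "k + 1" "k + 2"] det[of k "k + 2"]
        x01[of k] x01[of "k + 1"] that by (auto simp: numeral_3_eq_3)
    then show ?thesis
      using det[of "k + 1" "k + 3"] x01[of "k + 1"] that by (auto simp: numeral_3_eq_3)
  qed
  obtain k where k: "k \<ge> Suc n" "s k \<noteq> s (k + 2)"
    using aper by blast
  then have "n \<le> k - 1" "Suc (k - 1) = k"
    by auto
  then show False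
    using per[of "k - 1"] k(2) by simp
qed

lemma T_pow_point:
  assumes s: "\<And>n. s n \<in> D" and aper: "\<And>m. \<exists>n\<ge>m. s n \<noteq> s (n + 2)"
  shows "(T ^^ n) (point s) = point (\<lambda>i. s (n + i))"
proof (induction n)
  case (Suc n)
  have "T (point (\<lambda>i. s (n + i))) = point (\<lambda>i. s (Suc n + i))"
    using point_unfold[of "\<lambda>i. s (n + i)"] T_branch[OF s point_inner[OF s aper, of "Suc n"], of n] s
    by simp
  with Suc show ?case by simp
qed simp

text \<open>The intervals are taken open so that \<open>T\<close> is continuous along the orbit and
  any finite part of the itinerary is stable under small changes of \<open>x\<close>.\<close>

definition follows :: "real \<Rightarrow> (nat \<Rightarrow> nat) \<Rightarrow> bool" where
  "follows x s \<longleftrightarrow> (\<forall>n. s n \<in> D \<and> (T ^^ n) x \<in> {l (s n)<..<r (s n)})"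

definition coded :: "real set" where
  "coded = {x. \<exists>s. follows x s}"

lemma follows_point:
  assumes s: "\<And>n. s n \<in> D" and aper: "\<And>m. \<exists>n\<ge>m. s n \<noteq> s (n + 2)"
  shows "follows (point s) s"
  unfolding follows_def
proof (intro allI conjI s)
  fix n
  have "point (\<lambda>i. s (n + i)) = branch (s n) (point (\<lambda>i. s (Suc n + i)))"
    using point_unfold[of "\<lambda>i. s (n + i)"] s by simp
  then show "(T ^^ n) (point s) \<in> {l (s n)<..<r (s n)}"
    unfolding T_pow_point[OF assms] using branch_mem_inner[OF s point_inner[OF assms, of "Suc n"], of n]
    by simp
qed

lemma coded_iff: "x \<in> coded \<longleftrightarrow> (\<forall>n. \<exists>a\<in>D. (T ^^ n) x \<in> {l a<..<r a})"
  unfolding coded_def follows_def mem_Collect_eq by (metis)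

lemma coded_in_unit: "x \<in> coded \<Longrightarrow> x \<in> {0<..<1}"
  unfolding coded_iff using bounds by (elim allE[of _ 0]) force

lemma follows_in_cyl_iff:
  assumes "follows x s" "x \<in> {0..1}" "set w \<subseteq> D"
  shows "(T ^^ n) x \<in> cyl w \<longleftrightarrow> occurs w s n"
proof -
  have "(T ^^ j) ((T ^^ n) x) \<in> {l (w ! j)..<r (w ! j)} \<longleftrightarrow> s (n + j) = w ! j"
    if "j < length w" for j
  proof -
    have "w ! j \<in> D"
      using assms(3) that by auto
    moreover have "s (n + j) \<in> D" "(T ^^ (n + j)) x \<in> {l (s (n + j))..<r (s (n + j))}"
      using assms(1) by (auto simp: follows_def less_imp_le)
    ultimately show ?thesis
      using digit_unique by (auto simp: funpow_add add.commute)
  qed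
  moreover have "(T ^^ n) x \<in> {0..1}"
    using assms(2) by (rule T_pow_in_unit)
  ultimately show ?thesis
    unfolding gls_cylinder_def occurs_def by blast
qed

lemma visit_freq_cyl_eq:
  assumes "follows x s" "x \<in> {0..1}" "set w \<subseteq> D"
  shows "visit_freq T x (cyl w) = freq (occurs w s)"
  unfolding visit_freq_eq_freq follows_in_cyl_iff[OF assms] ..

text \<open>At a time when the orbit avoids all open intervals it is at a left end, which
  \<open>T\<close> sends to 0 or 1, or outside all intervals, which \<open>T\<close> sends to 0.
  From there on it stays in \<open>{0, 1}\<close>.\<close>

lemma not_coded_eventually_01:
  assumes "x \<in> {0..1}" "x \<notin> coded"
  obtains m where "\<And>n. n \<ge> m \<Longrightarrow> (T ^^ n) x \<in> {0, 1}"
proof -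
  obtain m where m: "\<And>a. a \<in> D \<Longrightarrow> (T ^^ m) x \<notin> {l a<..<r a}"
    using assms(2) unfolding coded_iff by blast
  define y where "y = (T ^^ m) x"
  have Ty: "T y \<in> {0, 1}"
  proof (cases "\<exists>a\<in>D. y \<in> {l a..<r a}")
    case True
    then obtain a where a: "a \<in> D" "y \<in> {l a..<r a}" by blast
    then have "y = l a"
      using m[OF a(1)] by (auto simp: y_def)
    then show ?thesis
      using T_on_digit[OF a] bounds(4)[OF a(1)] by (auto simp: len_def)
  next
    case False
    then show ?thesis
      using T_off_digits[of y] by auto
  qed
  have "(T ^^ n) x \<in> {0, 1}" if "n \<ge> Suc m" for n
    using that
  proof (induction n rule: dec_induct)
    case base
    then show ?case
      using Ty by (simp add: y_def)
  next
    case (step n)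
    then show ?case
      using T_01 by simp
  qed
  then show ?thesis
    using that by blast
qed

lemma not_coded_eventually_periodic:
  assumes "x \<in> {0..1}" "x \<notin> coded"
  obtains m where "\<And>n. n \<ge> m \<Longrightarrow> (T ^^ (n + 2)) x = (T ^^ n) x"
proof -
  obtain m where m: "\<And>n. n \<ge> m \<Longrightarrow> (T ^^ n) x \<in> {0, 1}"
    using not_coded_eventually_01[OF assms] by blast
  have "(T ^^ (n + 2)) x = (T ^^ n) x" if "n \<ge> Suc m" for n
  proof -
    define k where "k = n - 1"
    have "n = Suc k" "k \<ge> m"
      using that by (auto simp: k_def)
    then show ?thesis
      using T_01[OF m[of k]] by simp
  qed
  then show ?thesis
    using that by blast
qed

lemma not_coded_regular:
  assumes "x \<in> {0..1}" "x \<notin> coded"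
  shows "convergent (visit_freq T x A)"
proof -
  obtain m where "\<And>n. n \<ge> m \<Longrightarrow> (T ^^ (n + 2)) x = (T ^^ n) x"
    using not_coded_eventually_periodic[OF assms] by blast
  then show ?thesis
    unfolding visit_freq_eq_freq
    by (intro freq_eventually_periodic_convergent[of m]) presburger
qed

section \<open>Continuity along coded orbits, and \<open>G\<^sub>\<delta>\<close> sets of coded
  points\<close>

lemma isCont_T_inner:
  assumes "a \<in> D" "x \<in> {l a<..<r a}"
  shows "isCont T x"
proof -
  have "eventually (\<lambda>y. y \<in> {l a<..<r a}) (nhds x)"
    using assms(2) by (intro eventually_nhds_in_open) auto
  then have "eventually (\<lambda>y. T y = (if \<epsilon> a = 0 then (y - l a) / len a else (r a - y) / len a)) (nhds x)"
    by eventually_elim (rule T_on_digit[OF assms(1)], auto)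
  then have "isCont T x \<longleftrightarrow> isCont (\<lambda>y. if \<epsilon> a = 0 then (y - l a) / len a else (r a - y) / len a) x"
    by (rule isCont_cong)
  moreover have "isCont (\<lambda>y. if \<epsilon> a = 0 then (y - l a) / len a else (r a - y) / len a) x"
    using bounds(4)[OF assms(1)] by (cases "\<epsilon> a = 0") (auto intro!: continuous_intros)
  ultimately show ?thesis by blast
qed

lemma isCont_T_pow:
  assumes "\<And>m. m < n \<Longrightarrow> \<exists>a\<in>D. (T ^^ m) x \<in> {l a<..<r a}"
  shows "isCont (T ^^ n) x"
  using assms
proof (induction n)
  case 0
  then show ?case by (simp add: id_def)
next
  case (Suc n)
  obtain a where "a \<in> D" "(T ^^ n) x \<in> {l a<..<r a}"
    using Suc.prems by blast
  then have "isCont (T \<circ> (T ^^ n)) x"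
    using Suc by (intro continuous_at_compose isCont_T_inner[of a]) auto
  then show ?case by (simp add: comp_def)
qed

lemma eventually_T_pow_in_open:
  assumes "x \<in> coded" "open U" "(T ^^ n) x \<in> U"
  shows "\<forall>\<^sub>F y in nhds x. (T ^^ n) y \<in> U"
proof -
  have "isCont (T ^^ n) x"
    using assms(1) unfolding coded_iff by (intro isCont_T_pow) blast
  then have "((T ^^ n) \<longlongrightarrow> (T ^^ n) x) (nhds x)"
    by (simp add: isCont_def tendsto_at_iff_tendsto_nhds)
  then show ?thesis
    using assms(2,3) by (rule topological_tendstoD)
qed

lemma eventually_in_cyl_iff:
  assumes x: "x \<in> coded" and w: "set w \<subseteq> D"
  shows "\<forall>\<^sub>F y in nhds x. (T ^^ n) y \<in> cyl w \<longleftrightarrow> (T ^^ n) x \<in> cyl w"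
proof -
  obtain s where s: "follows x s"
    using x by (auto simp: coded_def)
  have sD: "s i \<in> D" and sx: "(T ^^ i) x \<in> {l (s i)<..<r (s i)}" for i
    using s by (auto simp: follows_def)
  \<comment> \<open>The range includes \<open>length w\<close> so that \<open>j = 0\<close> is
    available for the empty word too; it is what places the iterate of \<open>y\<close> in the unit
    interval.\<close>
  have "\<forall>\<^sub>F y in nhds x. \<forall>j\<in>{..length w}. (T ^^ (n + j)) y \<in> {l (s (n + j))<..<r (s (n + j))}"
    by (intro eventually_ball_finite ballI eventually_T_pow_in_open[OF x] sx) auto
  then show ?thesis
  proof eventually_elim
    case (elim y)
    have "(T ^^ n) y \<in> {l (s n)<..<r (s n)}"
      using elim[rule_format, of 0] by simp
    then have unit: "(T ^^ n) y \<in> {0..1}" "(T ^^ n) x \<in> {0..1}"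
      using bounds[OF sD[of n]] T_pow_in_unit[of x n] coded_in_unit[OF x] by auto
    have "(T ^^ j) ((T ^^ n) y) \<in> {l (w ! j)..<r (w ! j)} \<longleftrightarrow>
        (T ^^ j) ((T ^^ n) x) \<in> {l (w ! j)..<r (w ! j)}" if "j < length w" for j
    proof -
      have wj: "w ! j \<in> D"
        using w that by auto
      have "(T ^^ (n + j)) z \<in> {l (w ! j)..<r (w ! j)} \<longleftrightarrow> s (n + j) = w ! j"
        if "(T ^^ (n + j)) z \<in> {l (s (n + j))<..<r (s (n + j))}" for z
        using that digit_unique[OF wj sD, of "(T ^^ (n + j)) z" "n + j"] by auto
      then show ?thesis
        using elim that sx[of "n + j"] by (simp add: funpow_add add.commute)
    qed
    then show ?case
      using unit unfolding gls_cylinder_def by blast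
  qed
qed

text \<open>Conditions on finitely many visit frequencies thus become open at coded points, as
  \<open>gdelta_frequently\<close> demands.\<close>

lemma eventually_visit_freq_eq:
  assumes "x \<in> coded" "set w \<subseteq> D"
  shows "\<forall>\<^sub>F y in nhds x. visit_freq T y (cyl w) N = visit_freq T x (cyl w) N"
proof -
  have "\<forall>\<^sub>F y in nhds x. \<forall>n\<in>{..<N}. (T ^^ n) y \<in> cyl w \<longleftrightarrow> (T ^^ n) x \<in> cyl w"
    by (intro eventually_ball_finite ballI eventually_in_cyl_iff assms) auto
  then show ?thesis
  proof eventually_elim
    case (elim y)
    then have "{n. n < N \<and> (T ^^ n) y \<in> cyl w} = {n. n < N \<and> (T ^^ n) x \<in> cyl w}"
      by auto
    then show ?case
      by (simp add: visit_freq_def)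
  qed
qed

lemma interior_iff_eventually: "x \<in> interior {x. P x} \<longleftrightarrow> (\<forall>\<^sub>F y in nhds x. P y)"
  by (auto simp: interior_def eventually_nhds)

lemma gdelta_coded: "gdelta_in unit_top coded"
  unfolding gdelta_in_iff_Inter
proof (intro exI conjI allI)
  define C where "C n = {0..1} \<inter> interior {x. \<exists>a\<in>D. (T ^^ n) x \<in> {l a<..<r a}}" for n
  show "openin unit_top (C n)" for n
    unfolding C_def by (auto simp: openin_open)
  have "x \<in> C n" if x: "x \<in> coded" for x n
  proof -
    obtain a where a: "a \<in> D" "(T ^^ n) x \<in> {l a<..<r a}"
      using x by (auto simp: coded_iff)
    have "\<forall>\<^sub>F y in nhds x. (T ^^ n) y \<in> {l a<..<r a}"
      using x a by (intro eventually_T_pow_in_open) auto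
    then have "\<forall>\<^sub>F y in nhds x. \<exists>a\<in>D. (T ^^ n) y \<in> {l a<..<r a}"
      by eventually_elim (use a in blast)
    then show ?thesis
      using coded_in_unit[OF x] by (auto simp: C_def interior_iff_eventually)
  qed
  then show "coded = \<Inter>(range C)"
    using interior_subset by (fastforce simp: C_def coded_iff)
qed

text \<open>\<open>Q n\<close> is stable only at coded points. Passing to interiors gives genuinely
  open sets and loses no coded point; intersecting with \<open>coded\<close> discards the
  rest.\<close>

lemma gdelta_frequently:
  assumes "\<And>n x. x \<in> coded \<Longrightarrow> Q n x \<Longrightarrow> \<forall>\<^sub>F y in nhds x. Q n y"
  shows "gdelta_in unit_top {x \<in> coded. \<forall>N. \<exists>n\<ge>N. Q (n::nat) x}"
proof -
  define C where "C N = {0..1} \<inter> interior {x. \<exists>n\<ge>N. Q n x}" for N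
  have "openin unit_top (C N)" for N
    unfolding C_def by (auto simp: openin_open)
  then have "gdelta_in unit_top (coded \<inter> \<Inter>(range C))"
    by (intro gdelta_in_Int gdelta_coded) (auto simp: gdelta_in_iff_Inter)
  moreover have "coded \<inter> \<Inter>(range C) = {x \<in> coded. \<forall>N. \<exists>n\<ge>N. Q n x}"
  proof (intro equalityI subsetI)
    fix x assume "x \<in> coded \<inter> \<Inter>(range C)"
    then show "x \<in> {x \<in> coded. \<forall>N. \<exists>n\<ge>N. Q n x}"
      using interior_subset by (fastforce simp: C_def)
  next
    fix x assume x: "x \<in> {x \<in> coded. \<forall>N. \<exists>n\<ge>N. Q n x}"
    have "x \<in> C N" for N
    proof -
      obtain n where n: "n \<ge> N" "Q n x"
        using x by blast
      have "\<forall>\<^sub>F y in nhds x. Q n y"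
        using x n assms by blast
      then have "\<forall>\<^sub>F y in nhds x. \<exists>n\<ge>N. Q n y"
        by eventually_elim (use n in blast)
      then show ?thesis
        using coded_in_unit[of x] x by (auto simp: C_def interior_iff_eventually)
    qed
    then show "x \<in> coded \<inter> \<Inter>(range C)"
      using x by blast
  qed
  ultimately show ?thesis by simp
qed

end

section \<open>The reduction and the irregular points\<close>

text \<open>In the negation, one countable parameter \<open>q\<close> is followed by infinitely many
  \<open>n\<close> with a property witnessed by two terms: the shape handled by
  \<open>gdelta_frequently\<close>.\<close>

lemma convergent_iff_Cauchy_inverse_Suc:
  fixes X :: "nat \<Rightarrow> real"
  shows "convergent X \<longleftrightarrow> (\<forall>q. \<exists>N. \<forall>n\<ge>N. \<forall>m\<ge>n. \<bar>X n - X m\<bar> \<le> 1 / real (Suc q))"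
  unfolding Cauchy_convergent_iff[symmetric]
proof
  assume X: "Cauchy X"
  show "\<forall>q. \<exists>N. \<forall>n\<ge>N. \<forall>m\<ge>n. \<bar>X n - X m\<bar> \<le> 1 / real (Suc q)"
  proof
    fix q
    obtain N where N: "\<And>m n. m \<ge> N \<Longrightarrow> n \<ge> N \<Longrightarrow> dist (X m) (X n) < 1 / real (Suc q)"
      using X unfolding Cauchy_def by (metis of_nat_0_less_iff zero_less_Suc zero_less_divide_1_iff)
    then show "\<exists>N. \<forall>n\<ge>N. \<forall>m\<ge>n. \<bar>X n - X m\<bar> \<le> 1 / real (Suc q)"
      unfolding dist_real_def by (intro exI[of _ N]) (meson less_imp_le order_trans)
  qed
next
  assume X: "\<forall>q. \<exists>N. \<forall>n\<ge>N. \<forall>m\<ge>n. \<bar>X n - X m\<bar> \<le> 1 / real (Suc q)"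
  show "Cauchy X"
  proof (rule CauchyI')
    fix e :: real assume "0 < e"
    then obtain q where q: "1 / real (Suc q) < e"
      using nat_approx_posE by blast
    obtain N where N: "\<And>n m. n \<ge> N \<Longrightarrow> m \<ge> n \<Longrightarrow> \<bar>X n - X m\<bar> \<le> 1 / real (Suc q)"
      using X by blast
    show "\<exists>M. \<forall>m\<ge>M. \<forall>n>m. dist (X m) (X n) < e"
    proof (intro exI[of _ N] allI impI)
      fix m n assume "N \<le> m" "m < n"
      then show "dist (X m) (X n) < e"
        using N[of m n] q by (simp add: dist_real_def)
    qed
  qed
qed

lemma freq_const_tendsto: "freq (\<lambda>n. P) \<longlonglongrightarrow> of_bool P"
proof (rule tendsto_eventually)
  show "\<forall>\<^sub>F N in sequentially. freq (\<lambda>n. P) N = of_bool P"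
    using eventually_gt_at_top[of 0] by eventually_elim (simp add: freq_def)
qed

context gls_system
begin

text \<open>The markers enter \<open>G\<close> before the overriding, at positions that no window
  touches, so every value is a coded point.\<close>

definition code :: "nat \<Rightarrow> nat \<Rightarrow> (nat \<Rightarrow> nat) \<Rightarrow> (nat \<Rightarrow> nat) \<Rightarrow> real" where
  "code a b G z = point (override a (marked a b G) z)"

context
  fixes a b :: nat and G :: "nat \<Rightarrow> nat"
  assumes ab: "a \<in> D" "b \<in> D" "a \<noteq> b" and G: "\<And>n. G n \<in> D"
begin

lemma override_in_D: "override a (marked a b G) z n \<in> D"
  using ab G by (auto simp: override_def marked_def)

lemma follows_code: "follows (code a b G z) (override a (marked a b G) z)"
  unfolding code_def
proof (rule follows_point[OF override_in_D])
  fix m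
  let ?n = "4 ^ Suc m :: nat"
  have "m \<le> ?n"
    using less_power4[of "Suc m"] by linarith
  moreover have "override a (marked a b G) z ?n \<noteq> override a (marked a b G) z (?n + 2)"
    using override_marker[of 0 a "marked a b G" z "Suc m"]
      override_marker[of 2 a "marked a b G" z "Suc m"] marked_neq[OF ab(3), of G m]
    by (simp del: power_Suc)
  ultimately show "\<exists>n\<ge>m. override a (marked a b G) z n \<noteq> override a (marked a b G) z (n + 2)"
    by blast
qed

lemma code_coded: "code a b G z \<in> coded"
  using follows_code by (auto simp: coded_def)

lemma code_in_unit: "code a b G z \<in> {0..1}"
  using coded_in_unit[OF code_coded[of z]] by simp

lemma code_continuous:
  assumes U: "openin unit_top U" "code a b G z \<in> U"
  shows "\<exists>n. \<forall>z'. (\<forall>i<n. z' i = z i) \<longrightarrow> code a b G z' \<in> U"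
proof -
  obtain e where e: "e > 0" "\<And>y. y \<in> {0..1} \<Longrightarrow> dist y (code a b G z) < e \<Longrightarrow> y \<in> U"
    using U unfolding openin_euclidean_subtopology_iff by blast
  obtain \<rho> where \<rho>: "0 \<le> \<rho>" "\<rho> < 1" "\<And>a. a \<in> D \<Longrightarrow> len a \<le> \<rho>"
    using contraction_ratio by blast
  obtain n where n: "\<rho> ^ n < e"
    using real_arch_pow_inv[OF e(1) \<rho>(2)] by blast
  show ?thesis
  proof (intro exI[of _ n] allI impI)
    fix z' assume z': "\<forall>i<n. z' i = z i"
    have "\<bar>code a b G z' - code a b G z\<bar> \<le> \<rho> ^ n"
      unfolding code_def using \<rho> override_in_D override_cong_prefix[OF z']
      by (intro point_prefix) auto
    then show "code a b G z' \<in> U"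
      using n by (intro e(2) code_in_unit) (simp add: dist_real_def)
  qed
qed

lemma visit_freq_code_tendsto:
  assumes "set w \<subseteq> D" "filterlim z at_top sequentially" "freq (occurs w G) \<longlonglongrightarrow> \<theta>"
  shows "visit_freq T (code a b G z) (cyl w) \<longlonglongrightarrow> \<theta>"
  unfolding visit_freq_cyl_eq[OF follows_code code_in_unit assms(1)]
  by (intro freq_occurs_override freq_occurs_marked assms)

lemma visit_freq_code_not_convergent:
  assumes "\<not> filterlim z at_top sequentially" "freq (occurs [a] G) \<longlonglongrightarrow> \<theta>" "\<theta> \<noteq> 1"
  shows "\<not> convergent (visit_freq T (code a b G z) (cyl [a]))"
proof -
  have occ: "occurs [a] s = (\<lambda>n. s n = a)" for s :: "nat \<Rightarrow> nat"
    by (auto simp: occurs_def)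
  have aD: "set [a] \<subseteq> D"
    using ab by simp
  show ?thesis
    unfolding visit_freq_cyl_eq[OF follows_code code_in_unit aD] occ
    using freq_override_not_convergent[OF assms(1) _ assms(3), of "marked a b G" a]
      freq_occurs_marked[OF assms(2), of a b] by (simp add: occ)
qed

end

text \<open>For coded points, a fixed word and a fixed oscillation bound define a
  \<open>G\<^sub>\<delta>\<close> set, and there are countably many such pairs.\<close>

lemma irregular_Sigma3: "{x \<in> {0..1}. gls_irregular D l r \<epsilon> x} \<in> borel_Sigma unit_top 3"
proof -
  define Q where "Q w q n x \<longleftrightarrow>
      (\<exists>m\<ge>n. \<not> \<bar>visit_freq T x (cyl w) n - visit_freq T x (cyl w) m\<bar> \<le> 1 / real (Suc q))"
    for w q n x
  define B where "B w q = {x \<in> coded. \<forall>N. \<exists>n\<ge>N. Q w q n x}" for w q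
  have "gdelta_in unit_top (B w q)" if w: "set w \<subseteq> D" for w q
    unfolding B_def
  proof (rule gdelta_frequently)
    fix n x assume x: "x \<in> coded" "Q w q n x"
    then obtain m where "m \<ge> n" and
      m: "\<not> \<bar>visit_freq T x (cyl w) n - visit_freq T x (cyl w) m\<bar> \<le> 1 / real (Suc q)"
      by (auto simp: Q_def)
    show "\<forall>\<^sub>F y in nhds x. Q w q n y"
      using eventually_visit_freq_eq[OF x(1) w, of n] eventually_visit_freq_eq[OF x(1) w, of m]
    proof eventually_elim
      case (elim y)
      then show ?case
        unfolding Q_def using m \<open>m \<ge> n\<close> by (intro exI[of _ m]) simp
    qed
  qed
  then have "\<Union>((\<lambda>(w, q). B w q) ` ({w. w \<noteq> [] \<and> set w \<subseteq> D} \<times> UNIV)) \<in> borel_Sigma unit_top 3"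
    by (intro borel_Sigma_3I) auto
  moreover have "{x \<in> {0..1}. gls_irregular D l r \<epsilon> x} =
      \<Union>((\<lambda>(w, q). B w q) ` ({w. w \<noteq> [] \<and> set w \<subseteq> D} \<times> UNIV))"
  proof (intro set_eqI)
    fix x
    have "x \<in> {x \<in> {0..1}. gls_irregular D l r \<epsilon> x} \<longleftrightarrow>
        x \<in> coded \<and> (\<exists>w. w \<noteq> [] \<and> set w \<subseteq> D \<and> \<not> convergent (visit_freq T x (cyl w)))"
      using not_coded_regular[of x] coded_in_unit[of x] unfolding gls_irregular_def by fastforce
    also have "\<dots> \<longleftrightarrow> x \<in> \<Union>((\<lambda>(w, q). B w q) ` ({w. w \<noteq> [] \<and> set w \<subseteq> D} \<times> UNIV))"
      unfolding convergent_iff_Cauchy_inverse_Suc B_def Q_def by auto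
    finally show "x \<in> {x \<in> {0..1}. gls_irregular D l r \<epsilon> x} \<longleftrightarrow>
        x \<in> \<Union>((\<lambda>(w, q). B w q) ` ({w. w \<noteq> [] \<and> set w \<subseteq> D} \<times> UNIV))" .
  qed
  ultimately show ?thesis by simp
qed

lemma irregular_not_Pi3: "{x \<in> {0..1}. gls_irregular D l r \<epsilon> x} \<notin> borel_Pi unit_top 3"
proof
  assume "{x \<in> {0..1}. gls_irregular D l r \<epsilon> x} \<in> borel_Pi unit_top 3"
  then obtain S where S: "S \<in> borel_Sigma unit_top 3"
    "{x \<in> {0..1}. gls_irregular D l r \<epsilon> x} = {0..1} - S"
    by (auto simp: borel_Pi_def)
  obtain a b where ab: "a \<in> D" "b \<in> D" "a \<noteq> b"
    using two_digits by blast
  \<comment> \<open>In a constant sequence every word has frequency 0 or 1, and \<open>[a]\<close>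
    has frequency 0, so overwriting by \<open>a\<close> is detectable.\<close>
  let ?G = "\<lambda>n::nat. b"
  have occ: "freq (occurs w ?G) \<longlonglongrightarrow> of_bool (\<forall>j<length w. b = w ! j)" for w
    unfolding occurs_def by (rule freq_const_tendsto)
  have "code a b ?G z \<in> S \<longleftrightarrow> filterlim z at_top sequentially" for z
  proof -
    have "gls_irregular D l r \<epsilon> (code a b ?G z) \<longleftrightarrow> \<not> filterlim z at_top sequentially"
    proof (cases "filterlim z at_top sequentially")
      case True
      then have "convergent (visit_freq T (code a b ?G z) (cyl w))" if "set w \<subseteq> D" for w
        using visit_freq_code_tendsto[OF ab ab(2) that True occ] by (auto simp: convergent_def)
      then show ?thesis
        using True by (auto simp: gls_irregular_def)
    next
      case False
      have "\<not> convergent (visit_freq T (code a b ?G z) (cyl [a]))"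
        using visit_freq_code_not_convergent[OF ab ab(2) False occ] ab by simp
      then show ?thesis
        using False ab unfolding gls_irregular_def by (metis empty_set empty_subsetI insert_subset list.simps(15) not_Cons_self2)
    qed
    moreover have "code a b ?G z \<in> {0..1}"
      using code_in_unit[OF ab ab(2)] .
    ultimately show ?thesis
      using S(2) by blast
  qed
  then have "S \<notin> borel_Sigma unit_top 3"
    using code_continuous[OF ab ab(2)] by (intro not_Sigma3_if_reduces_tendsto_infinity[where f = "code a b ?G"]) auto
  with S(1) show False by blast
qed

end

section \<open>Generating points\<close>

context gls_system
begin

lemma cyl_Nil: "cyl [] = {0..1}"
  by (auto simp: gls_cylinder_def)

lemma cyl_Cons:
  assumes "a \<in> D"
  shows "cyl (a # w) = {y \<in> {l a..<r a}. T y \<in> cyl w}"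
proof -
  have "(\<forall>j<length (a # w). (T ^^ j) y \<in> {l ((a # w) ! j)..<r ((a # w) ! j)}) \<longleftrightarrow>
      y \<in> {l a..<r a} \<and> (\<forall>j<length w. (T ^^ j) (T y) \<in> {l (w ! j)..<r (w ! j)})" for y
    by (simp only: length_Cons All_less_Suc2 nth_Cons_0 nth_Cons_Suc funpow_Suc_right comp_apply
        funpow_0 id_apply funpow.simps(1))
  moreover have "{l a..<r a} \<subseteq> {0..1}"
    using bounds[OF assms] by auto
  ultimately show ?thesis
    unfolding gls_cylinder_def using T_in_unit by blast
qed

lemma is_interval_cyl: "set w \<subseteq> D \<Longrightarrow> is_interval (cyl w)"
proof (induction w)
  case Nil
  then show ?case
    by (simp add: cyl_Nil is_interval_cc)
next
  case (Cons a w)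
  then have a: "a \<in> D" and w: "is_interval (cyl w)"
    by auto
  show ?case
    unfolding is_interval_1 cyl_Cons[OF a]
  proof (intro ballI allI impI)
    fix x y z assume x: "x \<in> {y \<in> {l a..<r a}. T y \<in> cyl w}" and y: "y \<in> {y \<in> {l a..<r a}. T y \<in> cyl w}"
      and z: "x \<le> z \<and> z \<le> y"
    have xI: "x \<in> {l a..<r a}" and yI: "y \<in> {l a..<r a}"
      using x y by auto
    then have zI: "z \<in> {l a..<r a}"
      using z by auto
    have "T x \<le> T z \<and> T z \<le> T y \<or> T y \<le> T z \<and> T z \<le> T x"
      unfolding T_on_digit[OF a xI] T_on_digit[OF a yI] T_on_digit[OF a zI]
      using z bounds(4)[OF a] by (simp add: divide_right_mono)
    then have "T z \<in> cyl w"
      using w x y unfolding is_interval_1 by blast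
    with zI show "z \<in> {y \<in> {l a..<r a}. T y \<in> cyl w}"
      by blast
  qed
qed

lemma cyl_diameter:
  assumes \<rho>: "0 \<le> \<rho>" "\<And>a. a \<in> D \<Longrightarrow> len a \<le> \<rho>"
    and "set w \<subseteq> D" "x \<in> cyl w" "y \<in> cyl w"
  shows "\<bar>x - y\<bar> \<le> \<rho> ^ length w"
  using assms(3-)
proof (induction w arbitrary: x y)
  case Nil
  then show ?case
    by (auto simp: cyl_Nil)
next
  case (Cons a w)
  then have a: "a \<in> D"
    by simp
  have xy: "x \<in> {l a..<r a}" "y \<in> {l a..<r a}" "T x \<in> cyl w" "T y \<in> cyl w"
    using Cons.prems by (auto simp: cyl_Cons[OF a])
  have "\<bar>T x - T y\<bar> = \<bar>x - y\<bar> / len a"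
    using bounds(4)[OF a] unfolding T_on_digit[OF a xy(1)] T_on_digit[OF a xy(2)]
    by (auto simp: abs_divide simp flip: diff_divide_distrib)
  then have "\<bar>x - y\<bar> = len a * \<bar>T x - T y\<bar>"
    using bounds(4)[OF a] by simp
  also have "\<dots> \<le> \<rho> * \<rho> ^ length w"
    using Cons xy \<rho> a by (intro mult_mono) auto
  finally show ?case by simp
qed

lemma prefix_in_cyl:
  assumes "follows x s" "x \<in> {0..1}"
  shows "x \<in> cyl (map s [0..<k])"
proof -
  have "set (map s [0..<k]) \<subseteq> D"
    using assms(1) by (auto simp: follows_def)
  from follows_in_cyl_iff[OF assms this, of 0] show ?thesis
    by (simp add: occurs_def)
qed

lemma cyl_inter_prefix:
  assumes "set v \<subseteq> D" "set w \<subseteq> D" "y \<in> cyl v" "y \<in> cyl w" "length v \<le> length w"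
  shows "v = take (length v) w"
proof (rule nth_equalityI)
  fix j assume j: "j < length v"
  then have "v ! j \<in> D" "w ! j \<in> D"
    using assms by auto
  moreover have "(T ^^ j) y \<in> {l (v ! j)..<r (v ! j)}" "(T ^^ j) y \<in> {l (w ! j)..<r (w ! j)}"
    using assms j unfolding gls_cylinder_def by auto
  ultimately show "v ! j = take (length v) w ! j"
    using digit_unique j by simp
qed (use assms in simp)

text \<open>Membership in a cylinder is locally constant at coded points. Frontiers of cylinders are
  therefore null sets for the measures considered below.\<close>

lemma frontier_cyl_disjoint_coded:
  assumes w: "set w \<subseteq> D"
  shows "unit_top frontier_of (cyl w) \<inter> coded = {}"
proof (intro equals0I)
  fix x assume x: "x \<in> unit_top frontier_of (cyl w) \<inter> coded"
  then have "\<forall>\<^sub>F y in nhds x. (T ^^ 0) y \<in> cyl w \<longleftrightarrow> (T ^^ 0) x \<in> cyl w"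
    using w by (intro eventually_in_cyl_iff) auto
  then obtain U where U: "open U" "x \<in> U" "\<And>y. y \<in> U \<Longrightarrow> y \<in> cyl w \<longleftrightarrow> x \<in> cyl w"
    unfolding eventually_nhds by auto
  define V where "V = {0..1} \<inter> U"
  have V: "openin unit_top V" "x \<in> V"
    using U coded_in_unit[of x] x by (auto simp: V_def openin_open)
  show False
  proof (cases "x \<in> cyl w")
    case True
    then have "x \<in> unit_top interior_of (cyl w)"
      unfolding interior_of_def using V U(3) by (auto simp: V_def)
    then show False
      using x by (simp add: frontier_of_def)
  next
    case False
    then have "V \<inter> cyl w = {}"
      using U(3) by (auto simp: V_def)
    then have "x \<notin> unit_top closure_of (cyl w)"
      unfolding in_closure_of using V by blast
    then show False
      using x by (simp add: frontier_of_def)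
  qed
qed

end

section \<open>Invariant measures without an atom at 0\<close>

locale gls_measure = gls_system D l r \<epsilon> + prob_space M
  for D l r \<epsilon> and M :: "real measure" +
  assumes sets_M: "sets M = sets (restrict_space borel {0..1})"
    and inv: "unit_invariant (gls_map D l r \<epsilon>) M"
    and zero_null: "measure M {0} = 0"
begin

lemma space_M: "space M = {0..1}"
  using sets_eq_imp_space_eq[OF sets_M] by (simp add: space_restrict_space)

lemma in_sets_M_iff: "A \<in> sets M \<longleftrightarrow> A \<subseteq> {0..1} \<and> A \<in> sets borel"
  unfolding sets_M by (subst sets_restrict_space_iff) auto

lemma T_measurable: "T \<in> measurable M M"
proof (rule measurableI)
  show "T x \<in> space M" for x
    using T_in_unit by (simp add: space_M)
next
  fix B assume "B \<in> sets M"
  then have B: "B \<in> sets borel"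
    by (simp add: in_sets_M_iff)
  define f where "f a x = (if \<epsilon> a = 0 then (x - l a) / len a else (r a - x) / len a)" for a x
  have f: "f a -` B \<in> sets borel" for a
  proof -
    have "f a \<in> borel_measurable borel"
      unfolding f_def by (cases "\<epsilon> a = 0") simp_all
    then show ?thesis
      using measurable_sets[OF _ B, of "f a" borel] by simp
  qed
  have "T -` B \<inter> space M =
      (\<Union>a\<in>D. {l a..<r a} \<inter> f a -` B) \<union> (if 0 \<in> B then {0..1} - (\<Union>a\<in>D. {l a..<r a}) else {})"
    (is "_ = ?R")
  proof (intro set_eqI)
    fix x
    show "x \<in> T -` B \<inter> space M \<longleftrightarrow> x \<in> ?R"
    proof (cases "\<exists>a\<in>D. x \<in> {l a..<r a}")
      case True
      then obtain a where a: "a \<in> D" "x \<in> {l a..<r a}" by blast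
      then have "x \<in> {0..1}"
        using bounds[OF a(1)] by auto
      moreover have "T x = f a x"
        using T_on_digit[OF a] by (simp add: f_def)
      moreover have "b = a" if "b \<in> D" "x \<in> {l b..<r b}" for b
        using digit_unique[OF that(1) a(1) that(2) a(2)] .
      then have "x \<in> (\<Union>a\<in>D. {l a..<r a} \<inter> f a -` B) \<longleftrightarrow> f a x \<in> B"
        using a by blast
      moreover have "x \<in> (\<Union>a\<in>D. {l a..<r a})"
        using a by blast
      ultimately show ?thesis
        unfolding space_M by simp
    next
      case False
      then show ?thesis
        using T_off_digits[of x] unfolding space_M by auto
    qed
  qed
  moreover have "?R \<in> sets borel"
    using f by (intro sets.Un sets.countable_UN'' sets.Int) auto
  moreover have "T -` B \<inter> space M \<subseteq> {0..1}"
    by (auto simp: space_M)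
  ultimately show "T -` B \<inter> space M \<in> sets M"
    by (simp add: in_sets_M_iff)
qed

lemma T_pow_measurable [measurable]: "T ^^ n \<in> measurable M M"
  by (rule measurable_compose_n) (rule T_measurable)

lemma measure_vimage_T_pow:
  assumes "B \<in> sets M"
  shows "measure M ((T ^^ n) -` B \<inter> space M) = measure M B"
proof (induction n)
  case 0
  then show ?case
    using sets.sets_into_space[OF assms] by (simp add: Int_absorb2)
next
  case (Suc n)
  let ?C = "(T ^^ n) -` B \<inter> space M"
  have C: "?C \<in> sets M"
    using assms by (rule measurable_sets[OF T_pow_measurable])
  have "(T ^^ Suc n) -` B \<inter> space M = T -` ?C \<inter> {0..1}"
    unfolding space_M using T_in_unit by (auto simp: funpow_swap1)
  also have "measure M \<dots> = measure M ?C"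
    using inv C unfolding unit_invariant_def measure_def by simp
  finally show ?case
    unfolding Suc .
qed

text \<open>The orbit of a point that is not coded hits 0, since it ends in \<open>{0, 1}\<close>
  and 1 is sent to 0. By invariance, hitting 0 at a given time has the probability of
  \<open>{0}\<close>.\<close>

lemma AE_coded: "AE x in M. x \<in> coded"
proof -
  have zero: "{0} \<in> sets M"
    by (simp add: in_sets_M_iff)
  have "AE x in M. (T ^^ n) x \<noteq> 0" for n
  proof -
    have "(T ^^ n) -` {0} \<inter> space M \<in> sets M"
      by (rule measurable_sets[OF T_pow_measurable zero])
    moreover have "measure M ((T ^^ n) -` {0} \<inter> space M) = 0"
      using measure_vimage_T_pow[OF zero] zero_null by simp
    ultimately have "AE x in M. x \<notin> (T ^^ n) -` {0} \<inter> space M"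
      using prob_eq_0 by blast
    then show ?thesis
      using AE_space by eventually_elim auto
  qed
  then have "AE x in M. \<forall>n. (T ^^ n) x \<noteq> 0"
    by (simp add: AE_all_countable)
  then show ?thesis
    using AE_space
  proof eventually_elim
    case (elim x)
    show ?case
    proof (rule ccontr)
      assume "x \<notin> coded"
      then obtain m where m: "\<And>n. n \<ge> m \<Longrightarrow> (T ^^ n) x \<in> {0, 1}"
        using not_coded_eventually_01[of x] elim(2) unfolding space_M by blast
      then have "(T ^^ m) x = 1"
        using elim(1) by auto
      then have "(T ^^ Suc m) x = 0"
        using T_1 by simp
      then show False
        using elim(1) by blast
    qed
  qed
qed

lemma measure_eq_0_if_disjoint_coded:
  assumes "A \<inter> coded = {}"
  shows "measure M A = 0"
proof (cases "A \<in> sets M")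
  case True
  have "AE x in M. x \<notin> A"
    using AE_coded by eventually_elim (use assms in blast)
  with True show ?thesis
    using prob_eq_0 by blast
\<comment> \<open>\<open>measure\<close> is 0 on non-measurable sets by default, which spares the
  callers a measurability proof for \<open>A\<close>.\<close>
qed (rule measure_notin_sets)

lemma cyl_measurable [measurable]: "cyl w \<in> sets M"
proof (cases "w = []")
  case True
  then show ?thesis
    by (simp add: cyl_Nil flip: space_M)
next
  case False
  define A where "A j = (T ^^ j) -` ({l (w ! j)..<r (w ! j)} \<inter> {0..1}) \<inter> space M" for j
  have "A j \<in> sets M" for j
    unfolding A_def by (rule measurable_sets[OF T_pow_measurable]) (simp add: in_sets_M_iff)
  then have "(\<Inter>j\<in>{..<length w}. A j) \<in> sets M"
    using False by (intro sets.finite_INT) auto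
  moreover have "cyl w = (\<Inter>j\<in>{..<length w}. A j)"
  proof (intro set_eqI)
    fix y
    have "y \<in> {0..1}" if "y \<in> A 0"
      using that by (simp add: A_def space_M)
    moreover have "0 \<in> {..<length w}"
      using False by simp
    ultimately show "y \<in> cyl w \<longleftrightarrow> y \<in> (\<Inter>j\<in>{..<length w}. A j)"
      using T_pow_in_unit[of y] unfolding gls_cylinder_def A_def space_M by blast
  qed
  ultimately show ?thesis by simp
qed

lemma generates_imp_cyl:
  assumes "generates T x M" "set w \<subseteq> D"
  shows "visit_freq T x (cyl w) \<longlonglongrightarrow> measure M (cyl w)"
proof -
  have "measure M (unit_top frontier_of (cyl w)) = 0"
    by (intro measure_eq_0_if_disjoint_coded frontier_cyl_disjoint_coded assms)
  moreover have "cyl w \<subseteq> {0..1}"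
    by (auto simp: gls_cylinder_def)
  ultimately show ?thesis
    using assms is_interval_cyl unfolding generates_def by blast
qed

text \<open>The degenerate intervals \<open>{0}\<close> and \<open>{1}\<close> have measure 0 and
  null frontier, so a generating point visits each with frequency 0. An orbit that ends in
  \<open>{0, 1}\<close> visits one of them at all late times.\<close>

lemma generates_imp_coded:
  assumes "generates T x M" "x \<in> {0..1}"
  shows "x \<in> coded"
proof (rule ccontr)
  assume "x \<notin> coded"
  then obtain m where m: "\<And>n. n \<ge> m \<Longrightarrow> (T ^^ n) x \<in> {0, 1}"
    using not_coded_eventually_01 assms(2) by blast
  have lim: "freq (\<lambda>n. (T ^^ n) x \<in> {c}) \<longlonglongrightarrow> 0" if "c \<in> {0, 1}" for c
  proof -
    have "c \<notin> coded"
      using coded_in_unit[of c] that by auto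
    then have null: "measure M A = 0" if "A \<subseteq> {c}" for A
      using that by (intro measure_eq_0_if_disjoint_coded) blast
    have "closedin unit_top {c}"
      using that by (auto simp: closedin_closed intro!: exI[of _ "{c}"])
    then have "measure M (unit_top frontier_of {c}) = 0"
      by (intro null frontier_of_subset_closedin)
    moreover have "{c} \<subseteq> {0..1}" "is_interval {c}"
      using that by (auto simp: is_interval_1)
    ultimately have "visit_freq T x {c} \<longlonglongrightarrow> measure M {c}"
      using assms(1) unfolding generates_def by blast
    then show ?thesis
      using null[of "{c}"] by (simp add: visit_freq_eq_freq)
  qed
  have "freq (\<lambda>n. n < m) \<longlonglongrightarrow> 0"
  proof (rule freq_nullI)
    fix e :: real assume "e > 0"
    moreover have "card {n. n < N \<and> n < m} \<le> m" for N
      using card_mono[of "{..<m}" "{n. n < N \<and> n < m}"] by auto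
    ultimately show "\<exists>C. \<forall>N. real (card {n. n < N \<and> n < m}) \<le> C + e * real N"
      by (intro exI[of _ "real m"] allI) (simp add: add_increasing2)
  qed
  then have "freq (\<lambda>n. n < m \<or> (T ^^ n) x \<in> {0} \<or> (T ^^ n) x \<in> {1}) \<longlonglongrightarrow> 0"
    by (intro freq_null_disj lim) auto
  moreover have "(n < m \<or> (T ^^ n) x \<in> {0} \<or> (T ^^ n) x \<in> {1}) = True" for n
    using m[of n] by auto
  ultimately have "freq (\<lambda>n. True) \<longlonglongrightarrow> 0"
    by simp
  then show False
    using LIMSEQ_unique[OF freq_const_tendsto[of True]] by force
qed

text \<open>
  Up to a null set, the interior of \<open>A\<close> is a disjoint union of cylinders: those that are maximal
  among the cylinders contained in \<open>A\<close>.
\<close>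

lemma visit_freq_liminf:
  assumes x: "x \<in> coded"
    and lim: "\<And>w. set w \<subseteq> D \<Longrightarrow> visit_freq T x (cyl w) \<longlonglongrightarrow> measure M (cyl w)"
    and e: "e > 0"
  shows "\<forall>\<^sub>F N in sequentially. measure M (unit_top interior_of A) - e < visit_freq T x A N"
proof -
  define W where "W = {w. set w \<subseteq> D \<and> cyl w \<subseteq> A \<and> (\<forall>k<length w. \<not> cyl (take k w) \<subseteq> A)}"
  \<comment> \<open>Limits of frequencies are only available for finite sums, so the maximal
    cylinders are exhausted by finite families along an enumeration of all words.\<close>
  define F where "F n = {w \<in> W. to_nat w < n}" for n
  define U where "U n = (\<Union>w\<in>F n. cyl w)" for n
  have WD: "set w \<subseteq> D" if "w \<in> W" for w
    using that by (simp add: W_def)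
  have disj: "v = w" if vw: "v \<in> W" "w \<in> W" "y \<in> cyl v" "y \<in> cyl w" for v w y
  proof -
    have *: "v = w" if "v \<in> W" "w \<in> W" "y \<in> cyl v" "y \<in> cyl w" "length v \<le> length w" for v w
    proof -
      have v: "v = take (length v) w"
        using that by (intro cyl_inter_prefix[of _ _ y] WD)
      have "\<not> length v < length w"
        using that(1,2) v unfolding W_def by (metis (mono_tags, lifting) mem_Collect_eq)
      then show ?thesis
        using v by simp
    qed
    show ?thesis
      using *[of v w] *[of w v] vw by (cases "length v \<le> length w") auto
  qed
  have finF: "finite (F n)" for n
  proof -
    have "finite (to_nat -` {..<n} :: nat list set)"
      by (rule finite_vimageI) (auto intro: inj_to_nat)
    then show ?thesis
      by (rule rev_finite_subset) (auto simp: F_def)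
  qed
  have sub: "y \<in> (\<Union>n. U n)" if y: "y \<in> coded" "y \<in> unit_top interior_of A" for y
  proof -
    obtain s where s: "follows y s"
      using y by (auto simp: coded_def)
    have sD: "set (map s [0..<k]) \<subseteq> D" for k
      using s by (auto simp: follows_def)
    have yu: "y \<in> {0..1}"
      using coded_in_unit[OF y(1)] by simp
    obtain V where V: "openin unit_top V" "y \<in> V" "V \<subseteq> A"
      using y(2) by (auto simp: interior_of_def)
    then obtain d where d: "d > 0" "\<And>z. z \<in> {0..1} \<Longrightarrow> dist z y < d \<Longrightarrow> z \<in> A"
      unfolding openin_euclidean_subtopology_iff by blast
    obtain \<rho> where \<rho>: "0 \<le> \<rho>" "\<rho> < 1" "\<And>a. a \<in> D \<Longrightarrow> len a \<le> \<rho>"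
      using contraction_ratio by blast
    obtain k where k: "\<rho> ^ k < d"
      using real_arch_pow_inv[OF d(1) \<rho>(2)] by blast
    have "cyl (map s [0..<k]) \<subseteq> A"
    proof
      fix z assume z: "z \<in> cyl (map s [0..<k])"
      have "\<bar>z - y\<bar> \<le> \<rho> ^ k"
        using cyl_diameter[OF \<rho>(1,3) sD z prefix_in_cyl[OF s yu]] by simp
      then show "z \<in> A"
        using z k by (intro d(2)) (auto simp: dist_real_def gls_cylinder_def)
    qed
    then have ex: "\<exists>k. cyl (map s [0..<k]) \<subseteq> A"
      by blast
    \<comment> \<open>The shortest prefix of the itinerary whose cylinder fits into \<open>A\<close>
      gives the maximal cylinder around \<open>y\<close>.\<close>
    define j where "j = (LEAST k. cyl (map s [0..<k]) \<subseteq> A)"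
    have "cyl (map s [0..<j]) \<subseteq> A"
      unfolding j_def by (rule LeastI_ex[OF ex])
    moreover have "\<not> cyl (map s [0..<i]) \<subseteq> A" if "i < j" for i
      using not_less_Least[of i "\<lambda>k. cyl (map s [0..<k]) \<subseteq> A"] that by (simp add: j_def)
    ultimately have "map s [0..<j] \<in> W"
      using sD by (auto simp: W_def take_map)
    then have "y \<in> U (Suc (to_nat (map s [0..<j])))"
      using prefix_in_cyl[OF s yu] unfolding U_def F_def by blast
    then show ?thesis by blast
  qed
  have Um: "U n \<in> sets M" for n
    unfolding U_def using finF by (intro sets.finite_UN) auto
  have "(\<lambda>n. measure M (U n)) \<longlonglongrightarrow> measure M (\<Union>n. U n)"
    using Um by (intro finite_Lim_measure_incseq) (auto simp: incseq_def U_def F_def intro: order_less_le_trans)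
  moreover have "measure M (unit_top interior_of A) \<le> measure M (\<Union>n. U n)"
  proof (rule finite_measure_mono_AE)
    show "AE y in M. y \<in> unit_top interior_of A \<longrightarrow> y \<in> (\<Union>n. U n)"
      using AE_coded by eventually_elim (use sub in blast)
  qed (use Um in auto)
  then have "measure M (unit_top interior_of A) - e < measure M (\<Union>n. U n)"
    using e by linarith
  ultimately have "\<forall>\<^sub>F n in sequentially. measure M (unit_top interior_of A) - e < measure M (U n)"
    by (intro order_tendstoD)
  then obtain n where n: "measure M (unit_top interior_of A) - e < measure M (U n)"
    by (meson eventually_sequentially order_refl)
  have "measure M (U n) = (\<Sum>w\<in>F n. measure M (cyl w))"
    unfolding U_def using finF disj
    by (intro finite_measure_finite_Union) (auto simp: disjoint_family_on_def F_def)
  moreover have "(\<lambda>N. \<Sum>w\<in>F n. visit_freq T x (cyl w) N) \<longlonglongrightarrow> (\<Sum>w\<in>F n. measure M (cyl w))"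
    by (intro tendsto_sum lim WD) (simp add: F_def)
  ultimately have "\<forall>\<^sub>F N in sequentially.
      measure M (unit_top interior_of A) - e < (\<Sum>w\<in>F n. visit_freq T x (cyl w) N)"
    using n by (intro order_tendstoD) auto
  then show ?thesis
  proof eventually_elim
    case (elim N)
    have "(\<Sum>w\<in>F n. visit_freq T x (cyl w) N) = freq (\<lambda>k. \<exists>w\<in>F n. (T ^^ k) x \<in> cyl w) N"
      unfolding visit_freq_eq_freq using finF disj
      by (intro freq_bex_disjoint[symmetric]) (auto simp: F_def)
    also have "\<dots> \<le> visit_freq T x A N"
      unfolding visit_freq_eq_freq by (rule freq_mono) (auto simp: F_def W_def)
    finally show ?case
      using elim by linarith
  qed
qed

text \<open>As in the portmanteau theorem, the lower bound \<open>visit_freq_liminf\<close> is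
  applied to \<open>I\<close> and to its complement. Both have null frontier, so their interiors
  have full measure in them, and the two lower bounds enclose the frequency of
  \<open>I\<close>.\<close>

lemma generatesI:
  assumes x: "x \<in> coded"
    and lim: "\<And>w. set w \<subseteq> D \<Longrightarrow> visit_freq T x (cyl w) \<longlonglongrightarrow> measure M (cyl w)"
  shows "generates T x M"
  unfolding generates_def
proof (intro allI impI, elim conjE)
  fix I :: "real set"
  assume I: "is_interval I" "I \<subseteq> {0..1}" "measure M (unit_top frontier_of I) = 0"
  have Im: "I \<in> sets M"
    using I by (simp add: in_sets_M_iff real_interval_borel_measurable)
  have relint: "measure M A \<le> measure M (unit_top interior_of A)"
    if A: "A \<subseteq> {0..1}" "measure M (unit_top frontier_of A) = 0" for A
  proof (rule finite_measure_mono_AE)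
    have meas: "C \<in> sets M" if "closedin unit_top C" for C
      using that closedin_subset[OF that] by (auto simp: in_sets_M_iff closedin_closed)
    have "unit_top frontier_of A \<in> sets M"
      by (intro meas closedin_frontier_of)
    then have "AE y in M. y \<notin> unit_top frontier_of A"
      using A(2) prob_eq_0 by blast
    then show "AE y in M. y \<in> A \<longrightarrow> y \<in> unit_top interior_of A"
      by eventually_elim (use A(1) closure_of_subset[of A unit_top] in \<open>auto simp: frontier_of_def\<close>)
    have "unit_top interior_of A = space M - (unit_top closure_of (topspace unit_top - A))"
      by (simp add: interior_of_closure_of space_M)
    also have "\<dots> \<in> sets M"
      by (intro sets.compl_sets meas closedin_closure_of)
    finally show "unit_top interior_of A \<in> sets M" .
  qed
  have frontier_compl: "measure M (unit_top frontier_of ({0..1} - I)) = 0"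
    using I(3) frontier_of_complement[of unit_top I] by simp
  have compl: "measure M ({0..1} - I) = 1 - measure M I"
    using prob_compl[OF Im] by (simp add: space_M)
  have xu: "x \<in> {0..1}"
    using coded_in_unit[OF x] by simp
  show "visit_freq T x I \<longlonglongrightarrow> measure M I"
  proof (rule LIMSEQ_I)
    fix e :: real assume e: "0 < e"
    have liminf: "\<forall>\<^sub>F N in sequentially. measure M (unit_top interior_of A) - e < visit_freq T x A N" for A
      by (rule visit_freq_liminf[OF x lim e])
    have "\<forall>\<^sub>F N in sequentially. norm (visit_freq T x I N - measure M I) < e"
      using liminf[of I] liminf[of "{0..1} - I"]
        eventually_gt_at_top[of 0]
    proof eventually_elim
      case (elim N)
      have "visit_freq T x ({0..1} - I) N = freq (\<lambda>n. \<not> (T ^^ n) x \<in> I) N"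
        unfolding visit_freq_eq_freq using T_pow_in_unit[OF xu] by (simp only: Diff_iff simp_thms)
      also have "\<dots> = 1 - visit_freq T x I N"
        unfolding visit_freq_eq_freq by (rule freq_not[OF elim(3)])
      finally show ?case
        using elim(1,2) relint[OF I(2,3)] relint[OF Diff_subset frontier_compl] compl by simp
    qed
    then show "\<exists>no. \<forall>n\<ge>no. norm (visit_freq T x I n - measure M I) < e"
      by (simp add: eventually_sequentially)
  qed
qed

lemma generates_iff:
  assumes "x \<in> {0..1}"
  shows "generates T x M \<longleftrightarrow>
    x \<in> coded \<and> (\<forall>w. set w \<subseteq> D \<longrightarrow> visit_freq T x (cyl w) \<longlonglongrightarrow> measure M (cyl w))"
  using generates_imp_coded generates_imp_cyl generatesI assms by blast

text \<open>The complement consists of the points that are not coded, an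
  \<open>F\<^sub>\<sigma>\<close> set whose closed pieces are \<open>G\<^sub>\<delta>\<close> by
  metrizability, and of countably many \<open>G\<^sub>\<delta>\<close> sets on which some cylinder
  frequency stays off its target infinitely often.\<close>

lemma generates_Pi3: "{x \<in> {0..1}. generates T x M} \<in> borel_Pi unit_top 3"
proof -
  define Q where "Q w q n x \<longleftrightarrow> \<not> \<bar>visit_freq T x (cyl w) n - measure M (cyl w)\<bar> < 1 / real (Suc q)"
    for w q n x
  define B where "B w q = {x \<in> coded. \<forall>N. \<exists>n\<ge>N. Q w q n x}" for w q
  have B: "gdelta_in unit_top (B w q)" if w: "set w \<subseteq> D" for w q
    unfolding B_def
  proof (rule gdelta_frequently)
    fix n x assume x: "x \<in> coded" "Q w q n x"
    show "\<forall>\<^sub>F y in nhds x. Q w q n y"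
      using eventually_visit_freq_eq[OF x(1) w, of n] by eventually_elim (use x(2) in \<open>simp add: Q_def\<close>)
  qed
  have "fsigma_in unit_top (topspace unit_top - coded)"
    using gdelta_coded by (simp add: gdelta_in_fsigma_in)
  then obtain C :: "nat \<Rightarrow> real set" where C': "\<forall>n. closedin unit_top (C n)"
    "\<Union>(range C) = topspace unit_top - coded"
    unfolding fsigma_in_ascending by blast
  have C: "\<And>n. closedin unit_top (C n)" "{0..1} - coded = \<Union>(range C)"
    using C' by simp_all
  have "gdelta_in unit_top (C n)" for n
    by (rule closed_imp_gdelta_in[OF metrizable_space_subtopology[OF metrizable_space_euclidean] C(1)])
  define \<F> where "\<F> = range C \<union> (\<lambda>(w, q). B w q) ` ({w. set w \<subseteq> D} \<times> UNIV)"
  have "\<Union>\<F> \<in> borel_Sigma unit_top 3"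
    using B \<open>\<And>n. gdelta_in unit_top (C n)\<close> by (intro borel_Sigma_3I) (auto simp: \<F>_def)
  moreover have "{x \<in> {0..1}. generates T x M} = topspace unit_top - \<Union>\<F>"
  proof (intro set_eqI)
    fix x
    have lim: "visit_freq T x (cyl w) \<longlonglongrightarrow> measure M (cyl w) \<longleftrightarrow> (\<forall>q. \<exists>N. \<forall>n\<ge>N. \<not> Q w q n x)" for w
      unfolding Q_def not_not
    proof
      assume "visit_freq T x (cyl w) \<longlonglongrightarrow> measure M (cyl w)"
      then show "\<forall>q. \<exists>N. \<forall>n\<ge>N. \<bar>visit_freq T x (cyl w) n - measure M (cyl w)\<bar> < 1 / real (Suc q)"
        by (intro allI) (drule LIMSEQ_D, auto)
    next
      assume R: "\<forall>q. \<exists>N. \<forall>n\<ge>N. \<bar>visit_freq T x (cyl w) n - measure M (cyl w)\<bar> < 1 / real (Suc q)"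
      show "visit_freq T x (cyl w) \<longlonglongrightarrow> measure M (cyl w)"
      proof (rule LIMSEQ_I)
        fix e :: real assume "0 < e"
        then obtain q where "1 / real (Suc q) < e"
          using nat_approx_posE by blast
        then show "\<exists>no. \<forall>n\<ge>no. norm (visit_freq T x (cyl w) n - measure M (cyl w)) < e"
          using R[rule_format, of q] by (auto intro: order_less_trans)
      qed
    qed
    have "x \<in> {x \<in> {0..1}. generates T x M} \<longleftrightarrow> x \<in> {0..1} \<and> x \<notin> {0..1} - coded \<and>
        (\<forall>w. set w \<subseteq> D \<longrightarrow> (\<forall>q. x \<notin> B w q))"
      using generates_iff[of x] unfolding lim B_def by auto
    also have "\<dots> \<longleftrightarrow> x \<in> topspace unit_top - \<Union>\<F>"
      unfolding C(2) \<F>_def by auto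
    finally show "x \<in> {x \<in> {0..1}. generates T x M} \<longleftrightarrow> x \<in> topspace unit_top - \<Union>\<F>" .
  qed
  ultimately show ?thesis
    unfolding borel_Pi_def by blast
qed

end

section \<open>Existence of generic sequences\<close>

lemma sum_lessThan_add:
  fixes f :: "nat \<Rightarrow> 'a::comm_monoid_add"
  shows "(\<Sum>n<a + b. f n) = (\<Sum>n<a. f n) + (\<Sum>j<b. f (a + j))"
  by (induction b) (simp_all add: add.assoc)

lemma sum_lessThan_square:
  fixes f :: "nat \<Rightarrow> 'a::comm_monoid_add"
  shows "(\<Sum>n<m\<^sup>2. f n) = (\<Sum>i<m. \<Sum>j<2 * i + 1. f (i\<^sup>2 + j))"
proof (induction m)
  case (Suc m)
  have "(Suc m)\<^sup>2 = m\<^sup>2 + (2 * m + 1)"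
    by (simp add: power2_eq_square)
  then show ?case
    using Suc by (simp only: sum_lessThan_add sum.lessThan_Suc)
qed simp

lemma freq_eq_sum: "freq P N = (\<Sum>n<N. of_bool (P n)) / real N"
proof -
  have "{n. n < N \<and> P n} = {n \<in> {..<N}. P n}"
    by auto
  then show ?thesis
    by (simp add: freq_def of_bool_def sum.If_cases Int_def)
qed

lemma floor_sqrt_add:
  assumes "j < 2 * i + 1"
  shows "floor_sqrt (i\<^sup>2 + j) = i"
  by (rule floor_sqrt_unique) (use assms in \<open>auto simp: power2_eq_square\<close>)

text \<open>Control at squares suffices: the assumed error at \<open>m ^ 2\<close> has order
  \<open>m powr (3 / 2)\<close>, and the at most \<open>2 * m\<close> positions after the last
  square contribute at most 1 each.\<close>

lemma freq_tendsto_from_blocks: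
  fixes \<theta> C K :: real
  assumes bound: "\<And>m. m \<ge> m0 \<Longrightarrow> \<exists>s. s\<^sup>2 \<le> K * real m ^ 3 \<and>
      \<bar>(\<Sum>n<m\<^sup>2. of_bool (P n) - \<theta>)\<bar> \<le> \<bar>s\<bar> + C"
    and \<theta>: "0 \<le> \<theta>" "\<theta> \<le> 1"
  shows "freq P \<longlonglongrightarrow> \<theta>"
proof -
  define B where "B m = (sqrt (K * real m ^ 3) + C + 2 * real m) / (real m)\<^sup>2" for m
  have "(\<lambda>m. sqrt K * (sqrt (real m ^ 3) / (real m)\<^sup>2) + C * (1 / (real m)\<^sup>2) + 2 * real m / (real m)\<^sup>2)
      \<longlonglongrightarrow> sqrt K * 0 + C * 0 + 0"
    by (intro tendsto_add tendsto_mult tendsto_const) real_asymp+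
  then have "B \<longlonglongrightarrow> 0"
    unfolding B_def by (simp add: real_sqrt_mult add_divide_distrib)
  moreover have "filterlim floor_sqrt at_top sequentially"
    unfolding filterlim_at_top eventually_sequentially
    by (auto simp: le_floor_sqrt_iff)
  ultimately have lim: "(\<lambda>N. B (floor_sqrt N)) \<longlonglongrightarrow> 0"
    by (rule filterlim_compose)
  have "\<forall>\<^sub>F N in sequentially. norm (freq P N - \<theta>) \<le> B (floor_sqrt N)"
    using eventually_ge_at_top[of "(Suc m0)\<^sup>2"]
  proof eventually_elim
    case (elim N)
    define m where "m = floor_sqrt N"
    have m: "m \<ge> Suc m0" "m\<^sup>2 \<le> N" "N < (Suc m)\<^sup>2"
      using elim Suc_floor_sqrt_power2_gt[of N] by (simp_all add: m_def le_floor_sqrt_iff)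
    define d where "d = N - m\<^sup>2"
    have N: "N = m\<^sup>2 + d" and d: "d \<le> 2 * m"
      using m by (auto simp: d_def power2_eq_square)
    let ?e = "\<lambda>n. of_bool (P n) - \<theta>"
    obtain s where s: "s\<^sup>2 \<le> K * real m ^ 3" "\<bar>\<Sum>n<m\<^sup>2. ?e n\<bar> \<le> \<bar>s\<bar> + C"
      using bound[of m] m(1) by auto
    have "\<bar>s\<bar> \<le> sqrt (K * real m ^ 3)"
      using s(1) by (rule real_le_rsqrt[of "\<bar>s\<bar>", simplified power2_abs])
    moreover have "\<bar>\<Sum>j<d. ?e (m\<^sup>2 + j)\<bar> \<le> real d"
    proof -
      have "\<bar>\<Sum>j<d. ?e (m\<^sup>2 + j)\<bar> \<le> (\<Sum>j<d. \<bar>?e (m\<^sup>2 + j)\<bar>)"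
        by (rule sum_abs)
      also have "\<dots> \<le> (\<Sum>j<d. 1)"
        using \<theta> by (intro sum_mono) (auto simp: of_bool_def)
      finally show ?thesis by simp
    qed
    ultimately have E: "\<bar>\<Sum>n<N. ?e n\<bar> \<le> sqrt (K * real m ^ 3) + C + 2 * real m"
      using s(2) d unfolding N sum_lessThan_add by linarith
    have Npos: "(real m)\<^sup>2 > 0" "(real m)\<^sup>2 \<le> real N"
      using m by (auto simp flip: of_nat_power)
    then have "real N > 0"
      by linarith
    note Npos = this Npos
    have "(\<Sum>n<N. ?e n) = (\<Sum>n<N. of_bool (P n)) - real N * \<theta>"
      by (simp only: sum_subtractf sum_constant card_lessThan)
    then have "freq P N - \<theta> = (\<Sum>n<N. ?e n) / real N"
      using Npos(1) by (simp only: freq_eq_sum diff_divide_distrib) simp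
    then have "\<bar>freq P N - \<theta>\<bar> = \<bar>\<Sum>n<N. ?e n\<bar> / real N"
      using Npos by (simp add: abs_divide)
    also have "\<dots> \<le> (sqrt (K * real m ^ 3) + C + 2 * real m) / real N"
      using E Npos by (intro divide_right_mono) auto
    also have "\<dots> \<le> B m"
      unfolding B_def using E Npos by (intro divide_left_mono mult_pos_pos) linarith+
    finally show ?case
      by (simp add: m_def)
  qed
  then have "(\<lambda>N. freq P N - \<theta>) \<longlonglongrightarrow> 0"
    by (rule Lim_null_comparison[OF _ lim])
  then show ?thesis
    by (simp add: LIM_zero_iff)
qed

context gls_measure
begin

text \<open>
  A deterministic law of large numbers: block \<open>i\<close> follows the orbit of a point \<open>x i\<close> that is chosen
  so that its discrepancies have a nonpositive weighted inner product with the accumulated ones.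
  Such a point exists because the discrepancies have mean zero, and the weighted sum of squares then
  grows no faster than in the independent case.
\<close>

lemma greedy_orbits:
  fixes B :: "nat \<Rightarrow> real set"
  assumes B: "\<And>v. B v \<in> sets M"
  obtains x where "\<And>i. x i \<in> coded"
    "\<And>v. freq (\<lambda>n. (T ^^ (n - (floor_sqrt n)\<^sup>2)) (x (floor_sqrt n)) \<in> B v) \<longlonglongrightarrow> measure M (B v)"
proof -
  \<comment> \<open>The discrepancy of \<open>B v\<close> over block \<open>i\<close>, whose
    \<open>2 * i + 1\<close> positions fill the gap between \<open>i ^ 2\<close> and
    \<open>(i + 1) ^ 2\<close>.\<close>
  define h where "h i v y = (\<Sum>j<2 * i + 1. of_bool ((T ^^ j) y \<in> B v) - measure M (B v))"
    for i v :: nat and y :: real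
  \<comment> \<open>The set \<open>B v\<close> is taken into account only from block
    \<open>v + 1\<close> on, so each stage handles finitely many sets.\<close>
  define g where "g i v y = (if v < i then h i v y else 0)" for i v y
  have h_le: "\<bar>h i v y\<bar> \<le> real (2 * i + 1)" for i v y
  proof -
    have "\<bar>h i v y\<bar> \<le> (\<Sum>j<2 * i + 1. \<bar>of_bool ((T ^^ j) y \<in> B v) - measure M (B v)\<bar>)"
      unfolding h_def by (rule sum_abs)
    also have "\<dots> \<le> (\<Sum>j<2 * i + 1. 1)"
      by (intro sum_mono) (auto simp: of_bool_def)
    finally show ?thesis by simp
  qed
  have hint: "integrable M (h i v)" and h0: "(\<integral>y. h i v y \<partial>M) = 0" for i v
  proof -
    have S: "(T ^^ j) -` B v \<inter> space M \<in> sets M" for j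
      by (rule measurable_sets[OF T_pow_measurable B])
    have ind: "of_bool ((T ^^ j) y \<in> B v) = (indicator ((T ^^ j) -` B v \<inter> space M) y :: real)"
      if "y \<in> space M" for j y
      using that by (simp add: indicator_def)
    have int: "integrable M (\<lambda>y. of_bool ((T ^^ j) y \<in> B v) :: real)" for j
      using S[of j] by (subst Bochner_Integration.integrable_cong[OF refl ind])
        (auto simp: emeasure_eq_measure)
    have "(\<integral>y. of_bool ((T ^^ j) y \<in> B v) \<partial>M) = measure M (B v)" for j
    proof -
      have "(\<integral>y. of_bool ((T ^^ j) y \<in> B v) \<partial>M) =
          (\<integral>y. indicator ((T ^^ j) -` B v \<inter> space M) y \<partial>M :: real)"
        by (intro Bochner_Integration.integral_cong refl ind)
      also have "\<dots> = measure M ((T ^^ j) -` B v \<inter> space M)"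
        using S[of j] by simp
      finally show ?thesis
        using measure_vimage_T_pow[OF B] by simp
    qed
    then show "integrable M (h i v)" "(\<integral>y. h i v y \<partial>M) = 0"
      unfolding h_def[abs_def] using int by (simp_all add: prob_space)
  qed
  \<comment> \<open>The weighted sum has integral 0 by invariance, so it cannot be positive at
    almost every point.\<close>
  have step: "\<exists>y\<in>coded. (\<Sum>v<i. (1 / 2) ^ v * S v * h i v y) \<le> 0" for i and S :: "nat \<Rightarrow> real"
  proof (rule ccontr)
    assume "\<not> ?thesis"
    then have pos: "0 < (\<Sum>v<i. (1 / 2) ^ v * S v * h i v y)" if "y \<in> coded" for y
      using that by (auto simp: not_le)
    have "0 < (\<integral>y. (\<Sum>v<i. (1 / 2) ^ v * S v * h i v y) \<partial>M)"
    proof (rule expectation_greater)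
      show "integrable M (\<lambda>y. \<Sum>v<i. (1 / 2) ^ v * S v * h i v y)"
        by (intro Bochner_Integration.integrable_sum integrable_mult_right hint)
      show "AE y in M. 0 < (\<Sum>v<i. (1 / 2) ^ v * S v * h i v y)"
        using AE_coded by eventually_elim (rule pos)
    qed
    also have "(\<integral>y. (\<Sum>v<i. (1 / 2) ^ v * S v * h i v y) \<partial>M) =
        (\<Sum>v<i. \<integral>y. (1 / 2) ^ v * S v * h i v y \<partial>M)"
      by (intro Bochner_Integration.integral_sum integrable_mult_right hint)
    also have "\<dots> = 0"
      by (simp add: h0)
    finally show False by simp
  qed
  define pick where "pick i S = (SOME y. y \<in> coded \<and> (\<Sum>v<i. (1 / 2) ^ v * S v * h i v y) \<le> 0)"
    for i S
  have pick: "pick i S \<in> coded" "(\<Sum>v<i. (1 / 2) ^ v * S v * h i v (pick i S)) \<le> 0" for i S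
    using someI_ex[of "\<lambda>y. y \<in> coded \<and> (\<Sum>v<i. (1 / 2) ^ v * S v * h i v y) \<le> 0"] step[of S i]
    unfolding pick_def by blast+
  define S where "S = rec_nat (\<lambda>v. 0) (\<lambda>i S v. S v + g i v (pick i S))"
  have S0: "S 0 v = 0" and SS: "S (Suc i) v = S i v + g i v (pick i (S i))" for i v
    by (simp_all add: S_def)
  define x where "x i = pick i (S i)" for i
  have Ssum: "S m v = (\<Sum>i<m. g i v (x i))" for m v
    by (induction m) (simp_all add: S0 SS x_def)
  have Sz: "S m v = 0" if "m \<le> v" for m v
    unfolding Ssum using that by (intro sum.neutral) (auto simp: g_def)
  define \<Phi> where "\<Phi> m = (\<Sum>v<m. (1 / 2) ^ v * (S m v)\<^sup>2)" for m
  have \<Phi>_step: "\<Phi> (Suc m) \<le> \<Phi> m + 2 * real (2 * m + 1) ^ 2" for m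
  proof -
    \<comment> \<open>Summable weights keep the quadratic term bounded independently of the number
      of sets; the cross term is nonpositive by the choice of \<open>x m\<close>.\<close>
    have geo: "(\<Sum>v<m. (1 / 2) ^ v) \<le> (2 :: real)"
    proof -
      have "(\<Sum>v<m. (1 / 2) ^ v) = 2 - 2 * (1 / 2 :: real) ^ m"
        by (induction m) simp_all
      then show ?thesis by simp
    qed
    have "S (Suc m) m = 0"
      using SS[of m m] Sz[of m m] by (simp add: g_def)
    then have "\<Phi> (Suc m) = (\<Sum>v<m. (1 / 2) ^ v * (S m v + h m v (x m))\<^sup>2)"
      by (simp add: \<Phi>_def SS g_def x_def)
    also have "\<dots> = (\<Sum>v<m. (1 / 2) ^ v * (S m v)\<^sup>2 + 2 * ((1 / 2) ^ v * S m v * h m v (x m)) +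
        (1 / 2) ^ v * (h m v (x m))\<^sup>2)"
      by (intro sum.cong refl) (simp add: power2_sum algebra_simps)
    also have "\<dots> = \<Phi> m + 2 * (\<Sum>v<m. (1 / 2) ^ v * S m v * h m v (x m)) +
        (\<Sum>v<m. (1 / 2) ^ v * (h m v (x m))\<^sup>2)"
      by (simp add: \<Phi>_def sum.distrib sum_distrib_left)
    also have "(\<Sum>v<m. (1 / 2) ^ v * (h m v (x m))\<^sup>2) \<le> (\<Sum>v<m. (1 / 2) ^ v * real (2 * m + 1) ^ 2)"
      using h_le by (intro sum_mono mult_left_mono) (auto intro: abs_le_square_iff[THEN iffD1] simp: abs_le_square_iff[symmetric])
    also have "\<dots> = (\<Sum>v<m. (1 / 2) ^ v) * real (2 * m + 1) ^ 2"
      by (simp add: sum_distrib_right)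
    also have "\<dots> \<le> 2 * real (2 * m + 1) ^ 2"
      using geo by (rule mult_right_mono) simp
    finally show ?thesis
      using pick(2)[of "S m" m] by (simp add: x_def)
  qed
  \<comment> \<open>The constant 8 works because the increment \<open>2 * (2 * m + 1) ^ 2\<close> is
    at most \<open>8 * (m + 1) ^ 3 - 8 * m ^ 3\<close>.\<close>
  have \<Phi>_le: "\<Phi> m \<le> 8 * real m ^ 3" for m
  proof (induction m)
    case (Suc m)
    have "\<Phi> (Suc m) \<le> 8 * real m ^ 3 + 2 * real (2 * m + 1) ^ 2"
      using \<Phi>_step[of m] Suc by linarith
    also have "\<dots> \<le> 8 * real (Suc m) ^ 3"
      by (simp add: power3_eq_cube power2_eq_square algebra_simps)
    finally show ?case .
  qed (simp add: \<Phi>_def)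
  show ?thesis
  proof (rule that)
    show "x i \<in> coded" for i
      using pick(1) by (simp add: x_def)
    fix v
    define P where "P n \<longleftrightarrow> (T ^^ (n - (floor_sqrt n)\<^sup>2)) (x (floor_sqrt n)) \<in> B v" for n
    \<comment> \<open>Accounts for the blocks \<open>i \<le> v\<close> that \<open>g\<close>
      ignores.\<close>
    define C where "C = (\<Sum>i\<le>v. \<bar>h i v (x i)\<bar>)"
    have "freq P \<longlonglongrightarrow> measure M (B v)"
    proof (rule freq_tendsto_from_blocks)
      fix m assume m: "m \<ge> Suc v"
      have "(S m v)\<^sup>2 \<le> 8 * 2 ^ v * real m ^ 3"
      proof -
        have "(1 / 2) ^ v * (S m v)\<^sup>2 \<le> \<Phi> m"
          unfolding \<Phi>_def using m
          by (intro member_le_sum[of v "{..<m}" "\<lambda>v. (1 / 2) ^ v * (S m v)\<^sup>2"]) auto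
        also have "\<dots> \<le> 8 * real m ^ 3"
          by (rule \<Phi>_le)
        finally show ?thesis
          by (simp add: power_divide field_simps)
      qed
      moreover have "\<bar>\<Sum>n<m\<^sup>2. of_bool (P n) - measure M (B v)\<bar> \<le> \<bar>S m v\<bar> + C"
      proof -
        have "(\<Sum>n<m\<^sup>2. of_bool (P n) - measure M (B v)) = (\<Sum>i<m. h i v (x i))"
          unfolding sum_lessThan_square h_def
          by (intro sum.cong refl) (simp add: P_def floor_sqrt_add)
        also have "\<dots> = (\<Sum>i<m. g i v (x i)) + (\<Sum>i<m. if v < i then 0 else h i v (x i))"
          unfolding sum.distrib[symmetric] g_def by (intro sum.cong) auto
        also have "(\<Sum>i<m. if v < i then 0 else h i v (x i)) = (\<Sum>i\<le>v. h i v (x i))"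
          using m by (intro sum.mono_neutral_cong_right) auto
        finally show ?thesis
          using sum_abs[of "\<lambda>i. h i v (x i)" "{..v}"] unfolding Ssum[symmetric] C_def by linarith
      qed
      ultimately show "\<exists>s. s\<^sup>2 \<le> 8 * 2 ^ v * real m ^ 3 \<and>
          \<bar>\<Sum>n<m\<^sup>2. of_bool (P n) - measure M (B v)\<bar> \<le> \<bar>s\<bar> + C"
        by blast
    qed auto
    then show "freq (\<lambda>n. (T ^^ (n - (floor_sqrt n)\<^sup>2)) (x (floor_sqrt n)) \<in> B v) \<longlonglongrightarrow> measure M (B v)"
      by (simp add: P_def[abs_def])
  qed
qed

text \<open>\<open>greedy_orbits\<close> is applied to all cylinders, enumerated by
  \<open>from_nat\<close>. Reading a word in \<open>G\<close> instead of along the orbit of the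
  current block makes a difference only where the word crosses the end of the block.\<close>

lemma generic_sequence:
  obtains G where "\<And>n. G n \<in> D"
    "\<And>w. set w \<subseteq> D \<Longrightarrow> freq (occurs w G) \<longlonglongrightarrow> measure M (cyl w)"
proof -
  obtain x where x: "\<And>i. x i \<in> coded" and
    lim: "\<And>v. freq (\<lambda>n. (T ^^ (n - (floor_sqrt n)\<^sup>2)) (x (floor_sqrt n)) \<in> cyl (from_nat v))
      \<longlonglongrightarrow> measure M (cyl (from_nat v))"
    using greedy_orbits[of "\<lambda>v. cyl (from_nat v)", OF cyl_measurable] by blast
  have "\<forall>i. \<exists>s. follows (x i) s"
    using x by (simp add: coded_def)
  then obtain s where s: "\<And>i. follows (x i) (s i)"
    by metis
  define G where "G n = s (floor_sqrt n) (n - (floor_sqrt n)\<^sup>2)" for n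
  show ?thesis
  proof (rule that)
    show "G n \<in> D" for n
      using s unfolding G_def follows_def by blast
    fix w assume w: "set w \<subseteq> D"
    have unit: "x i \<in> {0..1}" for i
      using coded_in_unit[OF x[of i]] by simp
    have "freq (\<lambda>n. occurs w (s (floor_sqrt n)) (n - (floor_sqrt n)\<^sup>2)) \<longlonglongrightarrow> measure M (cyl w)"
      using lim[of "to_nat w"] by (simp add: follows_in_cyl_iff[OF s unit w])
    then show "freq (occurs w G) \<longlonglongrightarrow> measure M (cyl w)"
    proof (rule freq_tendsto_cong_null)
      show "freq (\<lambda>n. occurs w (s (floor_sqrt n)) (n - (floor_sqrt n)\<^sup>2) \<noteq> occurs w G n) \<longlonglongrightarrow> 0"
      proof (rule freq_null_mono[OF freq_null_floor_sqrt[of "length w"]], rule notI)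
        fix n assume neq: "occurs w (s (floor_sqrt n)) (n - (floor_sqrt n)\<^sup>2) \<noteq> occurs w G n"
          and eq: "floor_sqrt (n + length w) = floor_sqrt n"
        have "G (n + j) = s (floor_sqrt n) (n - (floor_sqrt n)\<^sup>2 + j)" if "j < length w" for j
        proof -
          have "floor_sqrt (n + j) = floor_sqrt n"
            using mono_floor_sqrt'[of n "n + j"] mono_floor_sqrt'[of "n + j" "n + length w"] that eq
            by simp
          then show ?thesis
            using floor_sqrt_power2_le[of n] by (simp add: G_def)
        qed
        then show False
          using neq by (simp add: occurs_def)
      qed
    qed
  qed
qed

lemma generates_not_Sigma3: "{x \<in> {0..1}. generates T x M} \<notin> borel_Sigma unit_top 3"
proof -
  obtain G where G: "\<And>n. G n \<in> D"
    "\<And>w. set w \<subseteq> D \<Longrightarrow> freq (occurs w G) \<longlonglongrightarrow> measure M (cyl w)"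
    using generic_sequence by blast
  \<comment> \<open>Overwriting by a digit of full measure would not be noticed; of two digits with
    disjoint cylinders, at least one is not of full measure.\<close>
  obtain a b where ab: "a \<in> D" "b \<in> D" "a \<noteq> b" "measure M (cyl [a]) \<noteq> 1"
  proof -
    obtain m n where mn: "m \<in> D" "n \<in> D" "m \<noteq> n"
      using two_digits by blast
    have "cyl [m] \<inter> cyl [n] = {}"
      using cyl_inter_prefix[of "[m]" "[n]"] mn by auto
    then have "measure M (cyl [m]) + measure M (cyl [n]) = measure M (cyl [m] \<union> cyl [n])"
      by (intro finite_measure_Union[symmetric]) auto
    also have "\<dots> \<le> 1"
      by (rule prob_le_1)
    finally have "measure M (cyl [m]) \<noteq> 1 \<or> measure M (cyl [n]) \<noteq> 1"
      by auto
    then show ?thesis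
      using that mn by metis
  qed
  note hyps = ab(1-3) G(1)
  have "code a b G z \<in> {x \<in> {0..1}. generates T x M} \<longleftrightarrow> filterlim z at_top sequentially" for z
  proof (cases "filterlim z at_top sequentially")
    case True
    have "generates T (code a b G z) M"
      by (intro generatesI code_coded visit_freq_code_tendsto hyps True G(2))
    then show ?thesis
      using True code_in_unit[OF hyps] by simp
  next
    case False
    have aD: "set [a] \<subseteq> D"
      using ab by simp
    have "\<not> generates T (code a b G z) M"
      using visit_freq_code_not_convergent[OF hyps False G(2)[OF aD] ab(4)]
        generates_imp_cyl[OF _ aD] by (auto simp: convergent_def)
    then show ?thesis
      using False by simp
  qed
  then show ?thesis
    using code_continuous[OF hyps] by (intro not_Sigma3_if_reduces_tendsto_infinity[where f = "code a b G"]) auto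
qed

end

theorem theorem11:
  fixes D :: "nat set" and l r :: "nat \<Rightarrow> real" and \<epsilon> :: "nat \<Rightarrow> nat"
  assumes "gls_family D l r"
    and "\<epsilon> \<in> D \<rightarrow> {0, 1}"
    and at_least_two_digits: "\<exists>m\<in>D. \<exists>n\<in>D. m \<noteq> n"
  shows "(\<forall>\<mu>. unit_borel_prob \<mu> \<and> unit_invariant (gls_map D l r \<epsilon>) \<mu> \<and> measure \<mu> {0} = 0 \<longrightarrow>
            Pi3_complete unit_top {x \<in> {0..1}. generates (gls_map D l r \<epsilon>) x \<mu>}) \<and>
         Sigma3_complete unit_top {x \<in> {0..1}. gls_irregular D l r \<epsilon> x}"
proof (intro conjI allI impI)
  interpret gls_system D l r \<epsilon>
    using assms(1,3) by unfold_locales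
  show "Sigma3_complete unit_top {x \<in> {0..1}. gls_irregular D l r \<epsilon> x}"
    using irregular_Sigma3 irregular_not_Pi3 by (simp add: Sigma3_complete_def)
  fix \<mu> assume \<mu>: "unit_borel_prob \<mu> \<and> unit_invariant (gls_map D l r \<epsilon>) \<mu> \<and> measure \<mu> {0} = 0"
  then interpret prob_space \<mu>
    by (simp add: unit_borel_prob_def)
  interpret gls_measure D l r \<epsilon> \<mu>
    using \<mu> by unfold_locales (simp_all add: unit_borel_prob_def)
  show "Pi3_complete unit_top {x \<in> {0..1}. generates (gls_map D l r \<epsilon>) x \<mu>}"
    using generates_Pi3 generates_not_Sigma3 by (simp add: Pi3_complete_def)
qed

end
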